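(* Let $1<\alpha<2$, $0\le r\le1$, $s\in\mathbb R$, and let $\beta$ be determined by $\alpha-1\le\beta\le 1$ and $$ r=\frac{\sin(\pi\beta)}{\sin(\pi(\alpha-\beta))+\sin(\pi\beta)} .$$ For $f\in H^s_{(\beta,\alpha-\beta)}(\mathrm I)$ there exists a unique solution $u$ to $$\mathcal L_r^\alpha u(x)=f(x),\quad x\in\mathrm I,\qquad \text{subject to } u(0)=u(1)=0,$$ which can be expressed as $u(x)=\rho^{(\alpha-\beta,\beta)}(x)\phi(x)$, where $\phi\in H^{s+\alpha}_{(\alpha-\beta,\beta)}(\mathrm I)$, with $$\|\phi\|_{s+\alpha,(\alpha-\beta,\beta)}\le C\,\|f\|_{s,(\beta,\alpha-\beta)}$$ for a constant $C$ independent of $f$.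
   Context: $\mathrm I=(0,1)$, $D$ is the usual derivative. The operator is $\mathcal L_r^\alpha u=-\left(rD^\alpha+(1-r)D^{\alpha*}\right)u$, where $$D^\alpha u(x)=D\,\frac{1}{\Gamma(2-\alpha)}\int_0^x\frac{1}{(x-s)^{\alpha-1}}Du(s)\,ds,\qquad D^{\alpha*}u(x)=D\,\frac1{\Gamma(2-\alpha)}\int_x^1\frac1{(s-x)^{\alpha-1}}Du(s)\,ds .$$ Weighted Sobolev spaces. For $a,b>-1$ let $\rho^{(a,b)}(x)=(1-x)^a x^b$ and $L^2_{\rho^{(a,b)}}(\mathrm I)=\{v:\int_0^1\rho^{(a,b)}v^2\,dx<\infty\}$. Let $G_j^{(a,b)}(x)=P_j^{(a,b)}(2x-1)$, where $P_j^{(a,b)}$ is the Jacobi polynomial on $(-1,1)$ (orthogonal for the weight $(1-t)^a(1+t)^b$), and $\widetilde G_j^{(a,b)}=G_j^{(a,b)}/\big(\int_0^1\rho^{(a,b)}(G_j^{(a,b)})^2dx\big)^{1/2}$. For $v\in L^2_{\rho^{(a,b)}}(\mathrm I)$ let $v_j=\int_0^1\rho^{(a,b)}v\,\widetilde G_j^{(a,b)}dx$. For $s\ge0$, $H^s_{(a,b)}(\mathrm I)=\{v\in L^2_{\rho^{(a,b)}}(\mathrm I):\|v\|_{s,(a,b)}^2:=\sum_{j\ge0}(1+j^2)^s v_j^2<\infty\}$. For $s>0$, $H^{-s}_{(a,b)}(\mathrm I)$ is the dual of $H^s_{(a,b)}(\mathrm I)$, identified with the formal series $f=\sum_{j\ge0}f_j\widetilde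 G_j^{(a,b)}$ with $\|f\|_{-s,(a,b)}^2=\sum_j(1+j^2)^{-s}f_j^2<\infty$, acting by $g\mapsto\sum_j f_jg_j$. Solutions are sought in the space of products $u=\rho^{(\alpha-\beta,\beta)}\phi$ with $\phi\in H^{s+\alpha}_{(\alpha-\beta,\beta)}(\mathrm I)$ (the factor $\rho^{(\alpha-\beta,\beta)}$ encoding the boundary condition). For $\phi=\sum_{j\ge0}\phi_j\widetilde G_j^{(\alpha-\beta,\beta)}$ with partial sums $\phi_N$, $\mathcal L_r^\alpha(\rho^{(\alpha-\beta,\beta)}\phi)$ is understood as the limit of $\mathcal L_r^\alpha(\rho^{(\alpha-\beta,\beta)}\phi_N)$ in $H^s_{(\beta,\alpha-\beta)}(\mathrm I)$. *)

theory Defs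
  imports "HOL-Analysis.Analysis"
begin

abbreviation unit_ivl :: "real set" where
  "unit_ivl \<equiv> {0<..<1}"

section \<open>Weights and Jacobi polynomials\<close>

definition rho :: "real \<Rightarrow> real \<Rightarrow> real \<Rightarrow> real" where
  "rho a b x = (1 - x) powr a * x powr b"

text \<open>Jacobi polynomials with the standard normalisation; they are orthogonal on
  \<open>(-1,1)\<close> for the weight \<open>(1 - t)^a (1 + t)^b\<close>.\<close>

definition jacobi :: "nat \<Rightarrow> real \<Rightarrow> real \<Rightarrow> real \<Rightarrow> real" where
  "jacobi n a b t =
     (\<Sum>m\<le>n. ((real n + a) gchoose m) * ((real n + b) gchoose (n - m))
              * ((t - 1) / 2) ^ (n - m) * ((t + 1) / 2) ^ m)"

definition G :: "real \<Rightarrow> real \<Rightarrow> nat \<Rightarrow> real \<Rightarrow> real" where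
  "G a b j x = jacobi j a b (2 * x - 1)"

definition Gn :: "real \<Rightarrow> real \<Rightarrow> nat \<Rightarrow> real \<Rightarrow> real" where
  "Gn a b j x = G a b j x / sqrt (LINT y:unit_ivl|lebesgue. rho a b y * (G a b j y)\<^sup>2)"

section \<open>Weighted Sobolev spaces of arbitrary real order\<close>

definition wL2 :: "real \<Rightarrow> real \<Rightarrow> (real \<Rightarrow> real) set" where
  "wL2 a b = {v. set_borel_measurable lebesgue unit_ivl v \<and>
                 set_integrable lebesgue unit_ivl (\<lambda>x. rho a b x * (v x)\<^sup>2)}"

definition jcoef :: "real \<Rightarrow> real \<Rightarrow> (real \<Rightarrow> real) \<Rightarrow> nat \<Rightarrow> real" where
  "jcoef a b v j = (LINT x:unit_ivl|lebesgue. rho a b x * v x * Gn a b j x)"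

text \<open>An element of a space of order \<open>s \<ge> 0\<close> is (a representative of) a function on the
  unit interval. For \<open>s < 0\<close> the space is the dual of the one of order \<open>-s\<close>, whose elements are
  identified with formal series \<open>\<Sum>j. c j * e j\<close>, written \<open>Series c e\<close>; here \<open>e = Gn a b\<close>.
  Keeping \<open>e\<close> explicit allows the formal series to be multiplied termwise by a weight.\<close>

datatype gfun = Fn "real \<Rightarrow> real" | Series "nat \<Rightarrow> real" "nat \<Rightarrow> real \<Rightarrow> real"

fun gfun_eq :: "gfun \<Rightarrow> gfun \<Rightarrow> bool" where
  "gfun_eq (Fn v) (Fn w) \<longleftrightarrow> (AE x in lebesgue. x \<in> unit_ivl \<longrightarrow> v x = w x)"
| "gfun_eq (Series c e) (Series d e') \<longleftrightarrow> c = d \<and> e = e'"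
| "gfun_eq _ _ \<longleftrightarrow> False"

primrec coef :: "real \<Rightarrow> real \<Rightarrow> gfun \<Rightarrow> nat \<Rightarrow> real" where
  "coef a b (Fn v) = jcoef a b v"
| "coef a b (Series c e) = c"

definition sob :: "real \<Rightarrow> real \<Rightarrow> real \<Rightarrow> gfun set" where
  "sob s a b =
     (if s \<ge> 0
      then {Fn v |v. v \<in> wL2 a b \<and>
                     summable (\<lambda>j. (1 + (real j)\<^sup>2) powr s * (jcoef a b v j)\<^sup>2)}
      else {Series c (Gn a b) |c. summable (\<lambda>j. (1 + (real j)\<^sup>2) powr s * (c j)\<^sup>2)})"

definition sob_norm :: "real \<Rightarrow> real \<Rightarrow> real \<Rightarrow> gfun \<Rightarrow> real" where
  "sob_norm s a b v = sqrt (\<Sum>j. (1 + (real j)\<^sup>2) powr s * (coef a b v j)\<^sup>2)"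

text \<open>The norm of the difference of two elements of \<open>sob s a b\<close>.\<close>

definition sob_dist :: "real \<Rightarrow> real \<Rightarrow> real \<Rightarrow> gfun \<Rightarrow> gfun \<Rightarrow> real" where
  "sob_dist s a b v w =
     sqrt (\<Sum>j. (1 + (real j)\<^sup>2) powr s * (coef a b v j - coef a b w j)\<^sup>2)"

text \<open>A function in \<open>wL2 a b\<close>, regarded as an element of the space of order \<open>s\<close>.\<close>

definition embed :: "real \<Rightarrow> real \<Rightarrow> real \<Rightarrow> (real \<Rightarrow> real) \<Rightarrow> gfun" where
  "embed s a b g = (if s \<ge> 0 then Fn g else Series (jcoef a b g) (Gn a b))"

definition partial_sum :: "real \<Rightarrow> real \<Rightarrow> gfun \<Rightarrow> nat \<Rightarrow> real \<Rightarrow> real" where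
  "partial_sum a b v N x = (\<Sum>j\<le>N. coef a b v j * Gn a b j x)"

section \<open>The fractional diffusion operator\<close>

definition frac_left :: "real \<Rightarrow> (real \<Rightarrow> real) \<Rightarrow> real \<Rightarrow> real" where
  "frac_left \<alpha> u =
     deriv (\<lambda>x. 1 / Gamma (2 - \<alpha>) *
                (LINT t:{0<..<x}|lebesgue. 1 / (x - t) powr (\<alpha> - 1) * deriv u t))"

definition frac_right :: "real \<Rightarrow> (real \<Rightarrow> real) \<Rightarrow> real \<Rightarrow> real" where
  "frac_right \<alpha> u =
     deriv (\<lambda>x. 1 / Gamma (2 - \<alpha>) *
                (LINT t:{x<..<1}|lebesgue. 1 / (t - x) powr (\<alpha> - 1) * deriv u t))"

definition frac_op :: "real \<Rightarrow> real \<Rightarrow> (real \<Rightarrow> real) \<Rightarrow> real \<Rightarrow> real" where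
  "frac_op r \<alpha> u x = - (r * frac_left \<alpha> u x + (1 - r) * frac_right \<alpha> u x)"

section \<open>Solutions of the boundary value problem\<close>

primrec weight_mult :: "(real \<Rightarrow> real) \<Rightarrow> gfun \<Rightarrow> gfun" where
  "weight_mult w (Fn v) = Fn (\<lambda>x. w x * v x)"
| "weight_mult w (Series c e) = Series c (\<lambda>j x. w x * e j x)"

text \<open>For a formal series the boundary condition is imposed on every term. For a product with
  \<open>rho a b\<close>, where \<open>a, b > 0\<close>, it holds because the weight vanishes at both end points.\<close>

primrec zero_bdry :: "gfun \<Rightarrow> bool" where
  "zero_bdry (Fn v) \<longleftrightarrow> v 0 = 0 \<and> v 1 = 0"
| "zero_bdry (Series c e) \<longleftrightarrow> (\<forall>j. e j 0 = 0 \<and> e j 1 = 0)"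

text \<open>The operator, applied to \<open>rho (\<alpha> - \<beta>) \<beta>\<close> times \<open>\<phi>\<close>, equals \<open>f\<close>: the left-hand
  side is the limit in \<open>sob s \<beta> (\<alpha> - \<beta>)\<close> of its values on the partial sums of \<open>\<phi>\<close>.
  Membership is required explicitly, since \<open>sob_dist\<close> is only meaningful on \<open>sob\<close> and
  \<open>embed\<close> only on \<open>wL2\<close>.\<close>

definition op_limit :: "real \<Rightarrow> real \<Rightarrow> real \<Rightarrow> real \<Rightarrow> gfun \<Rightarrow> gfun \<Rightarrow> bool" where
  "op_limit r \<alpha> \<beta> s \<phi> f \<longleftrightarrow>
     (let g = (\<lambda>N. frac_op r \<alpha> (\<lambda>x. rho (\<alpha> - \<beta>) \<beta> x * partial_sum (\<alpha> - \<beta>) \<beta> \<phi> N x))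
      in (\<forall>N. g N \<in> wL2 \<beta> (\<alpha> - \<beta>) \<and> embed s \<beta> (\<alpha> - \<beta>) (g N) \<in> sob s \<beta> (\<alpha> - \<beta>)) \<and>
         (\<lambda>N. sob_dist s \<beta> (\<alpha> - \<beta>) (embed s \<beta> (\<alpha> - \<beta>) (g N)) f) \<longlonglongrightarrow> 0)"

definition is_solution :: "real \<Rightarrow> real \<Rightarrow> real \<Rightarrow> real \<Rightarrow> gfun \<Rightarrow> gfun \<Rightarrow> bool" where
  "is_solution r \<alpha> \<beta> s f u \<longleftrightarrow>
     zero_bdry u \<and>
     (\<exists>\<phi>\<in>sob (s + \<alpha>) (\<alpha> - \<beta>) \<beta>. u = weight_mult (rho (\<alpha> - \<beta>) \<beta>) \<phi> \<and> op_limit r \<alpha> \<beta> s \<phi> f)"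

end

theory Submission
  imports Defs "HOL-Computational_Algebra.Polynomial"
begin

text \<open>Write \<open>a = \<alpha> - \<beta>\<close> and \<open>b = \<beta>\<close>. The operator is diagonal in Jacobi polynomials: it maps
  \<open>rho a b\<close> times \<open>G a b n\<close> to a positive multiple of \<open>G b a n\<close>, and the factor, which is
  \<open>pochhammer \<alpha> (n + 1) / n!\<close> up to a constant, grows like \<open>n powr \<alpha>\<close> (\<open>frac_op_jacobi\<close>,
  \<open>eigval_lower_bound\<close>). Since \<open>G a b n\<close> and \<open>G b a n\<close> have the same norm, the equation says that
  the coefficients of \<open>f\<close> are those of \<open>\<phi>\<close> multiplied by the eigenvalues (\<open>op_limit_iff\<close>). Dividing
  gives the unique solution and the estimate; square summable coefficients belong to a function by the
  theorem of Riesz and Fischer, and determine it by the density of polynomials.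

  The eigenfunction relation comes from triangularity and duality. Differentiating \<open>rho a b\<close> times
  a polynomial gives \<open>rho (a - 1) (b - 1)\<close> times a polynomial, so the operator is the derivative of a
  weakly singular potential of such functions. For the constant polynomial the left and the right
  fractional integrals have proportional derivatives (a degenerate hypergeometric identity), and the
  equation that defines \<open>\<beta>\<close> says exactly that they cancel: the potential is constant
  (\<open>potential_one_constant\<close>). From \<open>t = x - (x - t)\<close> one obtains a recursion in the degree which shows
  that the potential of every weighted polynomial is a polynomial of at most the same degree, with a
  computable leading coefficient (\<open>potential_poly\<close>). So the operator is triangular on weighted
  polynomials. Its adjoint is the operator with \<open>a, b\<close> and \<open>r, 1 - r\<close> exchanged, which is of the same
  kind (\<open>potential_adjoint\<close>). A triangular operator with triangular adjoint respects orthogonal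
  polynomials, and the leading coefficients give the eigenvalues.\<close>

section \<open>Fractional integrals of Jacobi weights\<close>

lemma borel_measurable_poly [measurable]: "(\<lambda>x. poly (p :: real poly) x) \<in> borel_measurable borel"
  by (intro borel_measurable_continuous_onI continuous_intros)

lemma borel_measurable_rho [measurable]: "rho a b \<in> borel_measurable borel"
  unfolding rho_def[abs_def] by measurable

lemma beta_integral_scaled:
  fixes d \<kappa> x :: real
  assumes "0 < d" "0 < \<kappa>" "0 < x"
  shows "has_bochner_integral lborel
           (\<lambda>t. indicator {0<..<x} t *\<^sub>R ((x - t) powr (\<kappa> - 1) * t powr (d - 1)))
           (x powr (\<kappa> + d - 1) * Beta d \<kappa>)"
proof -
  have I: "set_integrable lborel {0<..<1} (\<lambda>t::real. t powr (d - 1) * (1 - t) powr (\<kappa> - 1))"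
    by (rule set_integrable_subset[OF integrable_Beta[OF assms(1,2)]]) auto
  have "((\<lambda>t. t powr (d - 1) * (1 - t) powr (\<kappa> - 1)) has_integral Beta d \<kappa>) {0<..<1}"
    using has_integral_Beta_real[OF assms(1,2)] by (simp add: has_integral_Icc_iff_Ioo)
  then have "(LINT t:{0<..<1}|lborel. t powr (d - 1) * (1 - t) powr (\<kappa> - 1)) = Beta d \<kappa>"
    using set_borel_integral_eq_integral(2)[OF I] by (simp add: integral_unique)
  then have unit: "has_bochner_integral lborel
      (\<lambda>t. indicator {0<..<1} t *\<^sub>R (t powr (d - 1) * (1 - t) powr (\<kappa> - 1))) (Beta d \<kappa>)"
    using I unfolding set_integrable_def set_lebesgue_integral_def
    by (simp add: has_bochner_integral_iff)
  (* The substitution t = x s pulls the power of x out of the integral over (0,x). *)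
  have scaled: "x * indicator {0<..<x} (x * t) *\<^sub>R ((x - x * t) powr (\<kappa> - 1) * (x * t) powr (d - 1))
    = x powr (\<kappa> + d - 1) * indicator {0<..<1} t *\<^sub>R (t powr (d - 1) * (1 - t) powr (\<kappa> - 1))" for t
  proof (cases "0 < t \<and> t < 1")
    case True
    have "(x - x * t) powr (\<kappa> - 1) = x powr (\<kappa> - 1) * (1 - t) powr (\<kappa> - 1)"
      using assms True by (subst powr_mult[symmetric]) (auto simp: algebra_simps)
    moreover have "(x * t) powr (d - 1) = x powr (d - 1) * t powr (d - 1)"
      using assms True by (subst powr_mult) auto
    moreover have "x powr (\<kappa> + d - 1) = x * x powr (\<kappa> - 1) * x powr (d - 1)"
    proof -
      have "\<kappa> + d - 1 = 1 + (\<kappa> - 1) + (d - 1)" by simp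
      then have "x powr (\<kappa> + d - 1) = x powr (1 + (\<kappa> - 1) + (d - 1))" by (simp only:)
      also have "\<dots> = x powr 1 * x powr (\<kappa> - 1) * x powr (d - 1)" by (simp only: powr_add)
      finally show ?thesis using assms by simp
    qed
    ultimately show ?thesis using assms True by simp
  next
    case False
    then show ?thesis using assms by (auto simp: indicator_def zero_less_mult_iff)
  qed
  have "has_bochner_integral lborel
      (\<lambda>t. x powr (\<kappa> + d - 1) * indicator {0<..<1} t *\<^sub>R (t powr (d - 1) * (1 - t) powr (\<kappa> - 1)))
      (x powr (\<kappa> + d - 1) * Beta d \<kappa>)"
    using has_bochner_integral_mult_right[OF unit, of "x powr (\<kappa> + d - 1)"] by (simp add: mult_ac)
  then have "has_bochner_integral lborel
      (\<lambda>t. (1/x) * (x * indicator {0<..<x} (x * t) *\<^sub>R ((x - x * t) powr (\<kappa> - 1) * (x * t) powr (d - 1))))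
      ((1/x) * (x powr (\<kappa> + d - 1) * Beta d \<kappa>))"
    unfolding scaled by (rule has_bochner_integral_mult_right)
  moreover have "(1/x) * (x * i *\<^sub>R w) = i *\<^sub>R w" for i w :: real
    using assms by simp
  ultimately have "has_bochner_integral lborel
      (\<lambda>t. indicator {0<..<x} (x * t) *\<^sub>R ((x - x * t) powr (\<kappa> - 1) * (x * t) powr (d - 1)))
      ((x powr (\<kappa> + d - 1) * Beta d \<kappa>) /\<^sub>R \<bar>x\<bar>)"
    using assms by (simp only: divide_inverse mult_1 abs_of_pos real_scaleR_def)
  then show ?thesis
    using assms by (subst lborel_has_bochner_integral_real_affine_iff[of x _ _ 0]) simp_all
qed

text \<open>The Taylor coefficients of \<open>(1 - t) powr (a - 1)\<close> at \<open>0\<close>. They are nonnegative for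
  \<open>a \<le> 1\<close>, which is what makes termwise integration harmless.\<close>

definition pow_coef :: "real \<Rightarrow> nat \<Rightarrow> real" where
  "pow_coef a m = pochhammer (1 - a) m / fact m"

lemma pow_coef_nonneg: "a \<le> 1 \<Longrightarrow> 0 \<le> pow_coef a m"
  unfolding pow_coef_def
  by (cases "a = 1"; cases m) (auto simp: pochhammer_0_left intro!: divide_nonneg_nonneg pochhammer_nonneg)

lemma pow_coef_sums:
  fixes t :: real
  assumes "\<bar>t\<bar> < 1"
  shows "(\<lambda>m. pow_coef a m * t ^ m) sums (1 - t) powr (a - 1)"
proof -
  have "((a - 1) gchoose m) * (- t) ^ m = pow_coef a m * t ^ m" for m
    by (simp add: gbinomial_pochhammer pow_coef_def power_minus[of t])
  with gen_binomial_real[of "- t" "a - 1"] assms show ?thesis by simp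
qed

text \<open>Up to a constant this is the Gauss hypergeometric function with parameters
  \<open>1 - a\<close>, \<open>d\<close> and \<open>d + \<kappa>\<close>: the power series factor of the fractional integral of order
  \<open>\<kappa>\<close> of the weight \<open>rho (a - 1) (d - 1)\<close>.\<close>

definition beta_series :: "real \<Rightarrow> real \<Rightarrow> real \<Rightarrow> real \<Rightarrow> real" where
  "beta_series \<kappa> a d x = (\<Sum>m. pow_coef a m * Beta (d + m) \<kappa> * x ^ m)"

lemma Beta_pos: "0 < (a::real) \<Longrightarrow> 0 < b \<Longrightarrow> 0 < Beta a b"
  by (simp add: Beta_def)

lemma beta_series_summable:
  fixes \<kappa> d x :: real
  assumes "0 < \<kappa>" "0 < d" "a \<le> 1" "\<bar>x\<bar> < 1"
  shows "summable (\<lambda>m. pow_coef a m * Beta (d + m) \<kappa> * x ^ m)"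
proof (rule summable_comparison_test[OF _ summable_mult[of _ "Beta d \<kappa>"]])
  show "summable (\<lambda>m. pow_coef a m * \<bar>x\<bar> ^ m)"
    using pow_coef_sums[of "\<bar>x\<bar>" a] assms by (auto simp: sums_iff)
  have "norm (pow_coef a m * Beta (d + m) \<kappa> * x ^ m) \<le> Beta d \<kappa> * (pow_coef a m * \<bar>x\<bar> ^ m)" for m
  proof -
    have "Beta (d + m) \<kappa> \<le> Beta d \<kappa>" "0 < Beta (d + m) \<kappa>"
      using assms by (auto intro!: Beta_real_mono Beta_pos)
    then have "pow_coef a m * \<bar>x\<bar> ^ m * Beta (d + m) \<kappa> \<le> pow_coef a m * \<bar>x\<bar> ^ m * Beta d \<kappa>"
      "0 < Beta (d + m) \<kappa>"
      using pow_coef_nonneg[OF assms(3), of m] by (auto intro!: mult_left_mono)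
    then show ?thesis using pow_coef_nonneg[OF assms(3), of m]
      by (simp add: abs_mult power_abs mult_ac)
  qed
  then show "\<exists>N. \<forall>n\<ge>N. norm (pow_coef a n * Beta (d + n) \<kappa> * x ^ n) \<le> Beta d \<kappa> * (pow_coef a n * \<bar>x\<bar> ^ n)"
    by blast
qed

text \<open>Expand \<open>(1 - t) powr (a - 1)\<close> in its binomial series and integrate term by term.\<close>

lemma frac_integral_weight:
  fixes \<kappa> d x :: real
  assumes "0 < \<kappa>" "0 < d" "a \<le> 1" "0 < x" "x < 1"
  shows "has_bochner_integral lborel
           (\<lambda>t. indicator {0<..<x} t *\<^sub>R ((x - t) powr (\<kappa> - 1) * rho (a - 1) (d - 1) t))
           (x powr (\<kappa> + d - 1) * beta_series \<kappa> a d x)"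
proof -
  define f where "f m t = indicator {0<..<x} t *\<^sub>R ((x - t) powr (\<kappa> - 1) * t powr (d + real m - 1)) * pow_coef a m"
    for m t
  have term_int: "has_bochner_integral lborel (f m)
      (x powr (\<kappa> + d - 1) * (pow_coef a m * Beta (d + m) \<kappa> * x ^ m))" for m
  proof -
    have "x powr (\<kappa> + (d + real m) - 1) = x powr (\<kappa> + d - 1) * x ^ m"
      using assms by (simp add: powr_realpow[symmetric] powr_add[symmetric] algebra_simps)
    then show ?thesis
      using has_bochner_integral_mult_left[OF beta_integral_scaled[of "d + m" \<kappa> x], of "pow_coef a m"] assms
      by (simp add: f_def[abs_def] mult_ac)
  qed
  have sum_f: "(\<lambda>m. f m t) sums (indicator {0<..<x} t *\<^sub>R ((x - t) powr (\<kappa> - 1) * rho (a - 1) (d - 1) t))" for t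
  proof (cases "t \<in> {0<..<x}")
    case True
    have "t powr (d + real m - 1) = t powr (d - 1) * t ^ m" for m
      using True by (simp add: powr_realpow[symmetric] powr_add[symmetric] algebra_simps)
    then have "f m t = (x - t) powr (\<kappa> - 1) * t powr (d - 1) * (pow_coef a m * t ^ m)" for m
      using True by (simp add: f_def mult_ac)
    moreover have "\<dots> sums ((x - t) powr (\<kappa> - 1) * t powr (d - 1) * (1 - t) powr (a - 1))"
      using True assms by (intro sums_mult pow_coef_sums) auto
    ultimately show ?thesis using True by (simp add: rho_def mult_ac)
  qed (simp add: f_def)
  (* As a <= 1, all binomial coefficients are nonnegative, so absolute convergence
     of the series of integrals is the same as convergence. *)
  have f_nonneg: "0 \<le> f m t" for m t
    using pow_coef_nonneg[OF assms(3)] by (simp add: f_def)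
  have sm: "summable (\<lambda>m. x powr (\<kappa> + d - 1) * (pow_coef a m * Beta (d + m) \<kappa> * x ^ m))"
    using assms by (intro summable_mult beta_series_summable) auto
  have eq: "(\<Sum>m. f m t) = indicator {0<..<x} t *\<^sub>R ((x - t) powr (\<kappa> - 1) * rho (a - 1) (d - 1) t)" for t
    using sum_f[of t] by (simp add: sums_iff)
  have A: "integrable lborel (f m)" for m
    using term_int by (auto simp: has_bochner_integral_iff)
  have B: "AE t in lborel. summable (\<lambda>m. norm (f m t))"
    using sum_f f_nonneg by (auto simp: sums_iff)
  have C: "summable (\<lambda>m. \<integral>t. norm (f m t) \<partial>lborel)"
    using term_int f_nonneg sm by (simp add: has_bochner_integral_iff)
  have "integrable lborel (\<lambda>t. \<Sum>m. f m t)" by (rule integrable_suminf[OF A B C])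
  moreover have "(\<integral>t. (\<Sum>m. f m t) \<partial>lborel) = (\<Sum>m. integral\<^sup>L lborel (f m))"
    by (rule integral_suminf[OF A B C])
  moreover have "(\<Sum>m. integral\<^sup>L lborel (f m)) = x powr (\<kappa> + d - 1) * beta_series \<kappa> a d x"
    unfolding beta_series_def
    using term_int beta_series_summable[of \<kappa> d a x] assms
    by (subst suminf_mult[symmetric]) (auto simp: has_bochner_integral_iff)
  ultimately show ?thesis by (simp add: eq has_bochner_integral_iff)
qed

lemma powr_times_series_deriv:
  fixes x e :: real
  assumes sm: "\<And>y::real. \<bar>y\<bar> < 1 \<Longrightarrow> summable (\<lambda>m. c m * y ^ m)" and x: "0 < x" "x < 1"
  shows "((\<lambda>x. x powr e * (\<Sum>m. c m * x ^ m)) has_real_derivative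
           (\<Sum>m. (e + m) * c m * x ^ m) * x powr (e - 1)) (at x)"
    and "summable (\<lambda>m. (e + m) * c m * x ^ m)"
proof -
  have D: "((\<lambda>x. \<Sum>m. c m * x ^ m) has_real_derivative (\<Sum>m. diffs c m * x ^ m)) (at x)"
    by (rule termdiffs_strong'[of 1]) (use sm x in auto)
  have "summable (\<lambda>m. diffs c m * x ^ m)"
    by (rule termdiff_converges[of x 1]) (use sm x in auto)
  from diffs_equiv[OF this]
  have S: "(\<lambda>m. real m * c m * x ^ (m - Suc 0)) sums (\<Sum>m. diffs c m * x ^ m)" .
  have "x * (real m * c m * x ^ (m - Suc 0)) = real m * c m * x ^ m" for m
    by (cases m) auto
  with sums_mult[OF S, of x] have S': "(\<lambda>m. real m * c m * x ^ m) sums (x * (\<Sum>m. diffs c m * x ^ m))"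
    by simp
  have "(\<lambda>m. e * (c m * x ^ m)) sums (e * (\<Sum>m. c m * x ^ m))"
    using sm[of x] x by (intro sums_mult) auto
  from sums_add[OF this S']
  have T: "(\<lambda>m. (e + m) * c m * x ^ m) sums (e * (\<Sum>m. c m * x ^ m) + x * (\<Sum>m. diffs c m * x ^ m))"
    by (simp add: algebra_simps)
  then show "summable (\<lambda>m. (e + m) * c m * x ^ m)" by (simp add: sums_iff)
  have "x powr e = x * x powr (e - 1)"
    using x by (simp add: powr_diff)
  then have "e * x powr (e - 1) * (\<Sum>m. c m * x ^ m) + (\<Sum>m. diffs c m * x ^ m) * x powr e
     = (\<Sum>m. (e + m) * c m * x ^ m) * x powr (e - 1)"
    using T by (simp add: sums_iff algebra_simps)
  with DERIV_mult[OF has_real_derivative_powr[OF x(1), of e] D]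
  show "((\<lambda>x. x powr e * (\<Sum>m. c m * x ^ m)) has_real_derivative
           (\<Sum>m. (e + m) * c m * x ^ m) * x powr (e - 1)) (at x)" by simp
qed

text \<open>Raising the order of the fractional integral by one amounts to integrating once:
  termwise this is \<open>(x + y) B(x, y + 1) = y B(x, y)\<close>.\<close>

lemma beta_series_deriv:
  fixes \<kappa> d x :: real
  assumes "0 < \<kappa>" "0 < d" "a \<le> 1" "0 < x" "x < 1"
  shows "((\<lambda>x. x powr (\<kappa> + d) * beta_series (\<kappa> + 1) a d x) has_real_derivative
           \<kappa> * (x powr (\<kappa> + d - 1) * beta_series \<kappa> a d x)) (at x)"
proof -
  have "((\<kappa> + d) + m) * (pow_coef a m * Beta (d + m) (\<kappa> + 1)) = \<kappa> * (pow_coef a m * Beta (d + m) \<kappa>)" for m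
  proof -
    have "\<kappa> \<notin> \<int>\<^sub>\<le>\<^sub>0" using assms by (auto elim!: nonpos_Ints_cases)
    from Beta_plus1_right[OF this, of "d + m"]
    have "((\<kappa> + d) + m) * Beta (d + m) (\<kappa> + 1) = \<kappa> * Beta (d + m) \<kappa>"
      by (simp only: add_ac)
    then show ?thesis by (simp only: mult.left_commute)
  qed
  then have "(\<Sum>m. ((\<kappa> + d) + m) * (pow_coef a m * Beta (d + m) (\<kappa> + 1)) * x ^ m)
      = (\<Sum>m. \<kappa> * (pow_coef a m * Beta (d + m) \<kappa> * x ^ m))"
    by (simp only: mult.assoc)
  also have "\<dots> = \<kappa> * beta_series \<kappa> a d x"
    unfolding beta_series_def using assms by (intro suminf_mult beta_series_summable) auto
  finally have "(\<Sum>m. ((\<kappa> + d) + m) * (pow_coef a m * Beta (d + m) (\<kappa> + 1)) * x ^ m)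
      = \<kappa> * beta_series \<kappa> a d x" .
  then show ?thesis
    using powr_times_series_deriv(1)[of "\<lambda>m. pow_coef a m * Beta (d + m) (\<kappa> + 1)" x "\<kappa> + d"]
      beta_series_summable[of "\<kappa> + 1" d a] assms
    by (simp add: beta_series_def[abs_def] mult_ac)
qed

text \<open>For the order \<open>2 - (a + b)\<close> the hypergeometric parameters degenerate: the factor
  \<open>1 - a + m\<close> produced by differentiation cancels against the Beta value, and the binomial series
  of \<open>(1 - x) powr (- b)\<close> is left. Writing the constant with \<open>rGamma\<close> covers \<open>a = 1\<close>, where the
  derivative vanishes.\<close>

lemma beta_series_deriv_critical:
  fixes a b x :: real
  assumes "0 < a" "0 < b" "a \<le> 1" "a + b < 2" "0 < x" "x < 1"
  shows "((\<lambda>x. x powr (1 - a) * beta_series (2 - (a + b)) a b x) has_real_derivative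
           Gamma (2 - (a + b)) * Gamma b * rGamma (1 - a) * (x powr (- a) * (1 - x) powr (- b))) (at x)"
proof -
  let ?\<kappa> = "2 - (a + b)"
  have coef: "((1 - a) + m) * (pow_coef a m * Beta (b + m) ?\<kappa>)
      = Gamma ?\<kappa> * Gamma b * rGamma (1 - a) * pow_coef (1 - b) m" for m
  proof -
    have "b + m + ?\<kappa> = (1 - a) + m + 1" by simp
    then have B: "Beta (b + m) ?\<kappa> = Gamma (b + m) * Gamma ?\<kappa> * rGamma ((1 - a) + m + 1)"
      unfolding Beta_altdef by (simp only:)
    have "((1 - a) + m) * rGamma ((1 - a) + m + 1) = rGamma ((1 - a) + m)"
      by (rule rGamma_plus1)
    then have 1: "((1 - a) + m) * Beta (b + m) ?\<kappa> = Gamma (b + m) * Gamma ?\<kappa> * rGamma ((1 - a) + m)"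
      by (simp only: B mult.left_commute[of "(1 - a) + m"] mult.assoc)
    have 2: "pochhammer (1 - a) m * rGamma ((1 - a) + m) = rGamma (1 - a)"
      using pochhammer_rGamma[of "1 - a" m] by simp
    have 3: "Gamma (b + m) = pochhammer b m * Gamma b"
      using pochhammer_Gamma[of b m] assms by (simp add: field_simps Gamma_eq_zero_iff nonpos_Ints_def)
    have "((1 - a) + m) * (pow_coef a m * Beta (b + m) ?\<kappa>)
       = (pochhammer (1 - a) m / fact m) * (((1 - a) + m) * Beta (b + m) ?\<kappa>)"
      by (simp add: pow_coef_def)
    also have "\<dots> = (pochhammer (1 - a) m * rGamma ((1 - a) + m)) * Gamma (b + m) * Gamma ?\<kappa> / fact m"
      by (subst 1) simp
    also have "\<dots> = Gamma ?\<kappa> * Gamma b * rGamma (1 - a) * pow_coef (1 - b) m"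
      by (subst 2, subst 3) (simp add: pow_coef_def)
    finally show ?thesis .
  qed
  have "(\<lambda>m. Gamma ?\<kappa> * Gamma b * rGamma (1 - a) * (pow_coef (1 - b) m * x ^ m)) sums
      (Gamma ?\<kappa> * Gamma b * rGamma (1 - a) * (1 - x) powr (- b))"
    using pow_coef_sums[of x "1 - b"] assms by (intro sums_mult) simp
  then have S: "(\<Sum>m. ((1 - a) + m) * (pow_coef a m * Beta (b + m) ?\<kappa>) * x ^ m)
      = Gamma ?\<kappa> * Gamma b * rGamma (1 - a) * (1 - x) powr (- b)"
    unfolding coef by (simp add: sums_iff mult.assoc)
  show ?thesis
    using powr_times_series_deriv(1)[of "\<lambda>m. pow_coef a m * Beta (b + m) ?\<kappa>" x "1 - a", unfolded S]
      beta_series_summable[of ?\<kappa> b a] assms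
    by (simp add: beta_series_def[abs_def] mult_ac)
qed

section \<open>One-sided fractional integrals of weighted polynomials\<close>

text \<open>\<open>Gamma \<kappa>\<close> times the left Riemann-Liouville integral of order \<open>\<kappa>\<close> of a polynomial with
  Jacobi weight; \<open>right_int\<close> below is its mirror image. The exponents are shifted by one because such
  functions arise as derivatives of \<open>rho a b\<close> times a polynomial.\<close>

definition left_int :: "real \<Rightarrow> real \<Rightarrow> real \<Rightarrow> real poly \<Rightarrow> real \<Rightarrow> real" where
  "left_int \<kappa> a b p x = (LINT t:{0<..<x}|lborel. (x - t) powr (\<kappa> - 1) * (rho (a - 1) (b - 1) t * poly p t))"

definition right_int :: "real \<Rightarrow> real \<Rightarrow> real \<Rightarrow> real poly \<Rightarrow> real \<Rightarrow> real" where
  "right_int \<kappa> a b p x = (LINT t:{x<..<1}|lborel. (t - x) powr (\<kappa> - 1) * (rho (a - 1) (b - 1) t * poly p t))"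

lemma left_int_has_bochner_integral:
  fixes \<kappa> a b x :: real
  assumes "0 < \<kappa>" "0 < b" "a \<le> 1" "0 < x" "x < 1"
  shows "has_bochner_integral lborel
      (\<lambda>t. indicator {0<..<x} t *\<^sub>R ((x - t) powr (\<kappa> - 1) * (rho (a - 1) (b - 1) t * poly p t)))
      (\<Sum>k\<le>degree p. coeff p k * (x powr (\<kappa> + (b + k) - 1) * beta_series \<kappa> a (b + k) x))"
proof -
  have "indicator {0<..<x} t *\<^sub>R ((x - t) powr (\<kappa> - 1) * (rho (a - 1) (b - 1) t * poly p t))
     = (\<Sum>k\<le>degree p. coeff p k * (indicator {0<..<x} t *\<^sub>R ((x - t) powr (\<kappa> - 1) * rho (a - 1) (b + k - 1) t)))"
    for t
  proof (cases "t \<in> {0<..<x}")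
    case True
    then have "t powr (b + real k - 1) = t powr (b - 1) * t ^ k" for k
      by (simp add: powr_realpow[symmetric] powr_add[symmetric] algebra_simps)
    then show ?thesis using True
      by (simp add: rho_def poly_altdef sum_distrib_left mult_ac)
  qed simp
  moreover have "has_bochner_integral lborel
    (\<lambda>t. \<Sum>k\<le>degree p. coeff p k * (indicator {0<..<x} t *\<^sub>R ((x - t) powr (\<kappa> - 1) * rho (a - 1) (b + k - 1) t)))
      (\<Sum>k\<le>degree p. coeff p k * (x powr (\<kappa> + (b + k) - 1) * beta_series \<kappa> a (b + k) x))"
    using assms by (intro has_bochner_integral_sum has_bochner_integral_mult_right frac_integral_weight) auto
  ultimately show ?thesis by simp
qed

lemma left_int_integrable:
  fixes \<kappa> a b x :: real
  assumes "0 < \<kappa>" "0 < b" "a \<le> 1" "0 < x" "x < 1"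
  shows "set_integrable lborel {0<..<x} (\<lambda>t. (x - t) powr (\<kappa> - 1) * (rho (a - 1) (b - 1) t * poly p t))"
  using left_int_has_bochner_integral[OF assms] by (auto simp: set_integrable_def has_bochner_integral_iff)

lemma left_int_eq:
  fixes \<kappa> a b x :: real
  assumes "0 < \<kappa>" "0 < b" "a \<le> 1" "0 < x" "x < 1"
  shows "left_int \<kappa> a b p x
    = (\<Sum>k\<le>degree p. coeff p k * (x powr (\<kappa> + (b + k) - 1) * beta_series \<kappa> a (b + k) x))"
  using left_int_has_bochner_integral[OF assms]
  by (auto simp: left_int_def set_lebesgue_integral_def has_bochner_integral_iff)

text \<open>Multiplication of the density by \<open>t\<close> is multiplication of the integral by \<open>x\<close> up to an
  integral of higher order, because \<open>t = x - (x - t)\<close>. This is the recursion by which everything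
  is reduced to the constant polynomial.\<close>

lemma left_int_pCons:
  fixes \<kappa> a b x :: real
  assumes "0 < \<kappa>" "0 < b" "a \<le> 1" "0 < x" "x < 1"
  shows "left_int \<kappa> a b (pCons c p) x = c * left_int \<kappa> a b 1 x + x * left_int \<kappa> a b p x - left_int (\<kappa> + 1) a b p x"
proof -
  note I = left_int_integrable[OF assms] left_int_integrable[of "\<kappa> + 1" b a x]
  have "left_int \<kappa> a b (pCons c p) x = (LINT t:{0<..<x}|lborel.
      c * ((x - t) powr (\<kappa> - 1) * (rho (a - 1) (b - 1) t * poly 1 t))
      + x * ((x - t) powr (\<kappa> - 1) * (rho (a - 1) (b - 1) t * poly p t))
      - (x - t) powr (\<kappa> + 1 - 1) * (rho (a - 1) (b - 1) t * poly p t))"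
    unfolding left_int_def
  proof (rule set_lebesgue_integral_cong)
    have E: "(x - t) powr (\<kappa> + 1 - 1) = (x - t) * (x - t) powr (\<kappa> - 1)" if "t < x" for t
      using that by (simp add: powr_diff)
    then show "\<forall>t. t \<in> {0<..<x} \<longrightarrow> (x - t) powr (\<kappa> - 1) * (rho (a - 1) (b - 1) t * poly (pCons c p) t) =
        c * ((x - t) powr (\<kappa> - 1) * (rho (a - 1) (b - 1) t * poly 1 t))
      + x * ((x - t) powr (\<kappa> - 1) * (rho (a - 1) (b - 1) t * poly p t))
      - (x - t) powr (\<kappa> + 1 - 1) * (rho (a - 1) (b - 1) t * poly p t)"
      by (auto simp only: E poly_pCons poly_1 greaterThanLessThan_iff) (simp_all add: algebra_simps)
  qed simp
  also have "\<dots> = c * left_int \<kappa> a b 1 x + x * left_int \<kappa> a b p x - left_int (\<kappa> + 1) a b p x"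
    unfolding left_int_def using I assms
    by (simp only: set_integral_diff set_integral_add set_integrable_mult_right set_integral_mult_right
        add_pos_pos zero_less_one)
  finally show ?thesis .
qed

lemma left_int_deriv:
  fixes \<kappa> a b x :: real
  assumes "0 < \<kappa>" "0 < b" "a \<le> 1" "0 < x" "x < 1"
  shows "(left_int (\<kappa> + 1) a b p has_real_derivative \<kappa> * left_int \<kappa> a b p x) (at x)"
proof (rule has_field_derivative_transform_within_open[where S = "{0<..<1}"])
  have "((\<lambda>x. \<Sum>k\<le>degree p. coeff p k * (x powr (\<kappa> + (b + k)) * beta_series (\<kappa> + 1) a (b + k) x))
     has_real_derivative (\<Sum>k\<le>degree p. coeff p k * (\<kappa> * (x powr (\<kappa> + (b + k) - 1) * beta_series \<kappa> a (b + k) x)))) (at x)"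
    using assms by (intro DERIV_sum DERIV_cmult beta_series_deriv) auto
  then show "((\<lambda>x. \<Sum>k\<le>degree p. coeff p k * (x powr (\<kappa> + (b + k)) * beta_series (\<kappa> + 1) a (b + k) x))
     has_real_derivative \<kappa> * left_int \<kappa> a b p x) (at x)"
    using assms by (simp add: left_int_eq sum_distrib_left mult_ac)
  show "(\<Sum>k\<le>degree p. coeff p k * (y powr (\<kappa> + (b + k)) * beta_series (\<kappa> + 1) a (b + k) y)) = left_int (\<kappa> + 1) a b p y"
    if "y \<in> {0<..<1}" for y
    using assms that by (simp add: left_int_eq algebra_simps)
qed (use assms in auto)

lemma left_int_one_deriv:
  fixes a b x :: real
  assumes "0 < a" "a \<le> 1" "0 < b" "a + b < 2" "0 < x" "x < 1"
  shows "(left_int (2 - (a + b)) a b 1 has_real_derivative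
           Gamma (2 - (a + b)) * Gamma b * rGamma (1 - a) * (x powr (- a) * (1 - x) powr (- b))) (at x)"
proof (rule has_field_derivative_transform_within_open[where S = "{0<..<1}"])
  show "((\<lambda>x. x powr (1 - a) * beta_series (2 - (a + b)) a b x) has_real_derivative
           Gamma (2 - (a + b)) * Gamma b * rGamma (1 - a) * (x powr (- a) * (1 - x) powr (- b))) (at x)"
    using assms by (intro beta_series_deriv_critical) auto
  show "y powr (1 - a) * beta_series (2 - (a + b)) a b y = left_int (2 - (a + b)) a b 1 y"
    if "y \<in> {0<..<1}" for y
  proof -
    have "2 - (a + b) + b - 1 = 1 - a" by simp
    with assms that show ?thesis by (simp add: left_int_eq)
  qed
qed (use assms in auto)

text \<open>The recursion \<open>left_int_pCons\<close> transfers differentiability from the constant polynomial to all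
  polynomials. It is needed for each side separately, since the operator differentiates the left and
  the right integral before adding them.\<close>

lemma left_int_differentiable:
  fixes a b x :: real
  assumes "0 < a" "a \<le> 1" "0 < b" "a + b < 2" "0 < x" "x < 1"
  shows "\<exists>D. (left_int (2 - (a + b)) a b p has_real_derivative D) (at x)"
proof (induction p)
  case 0
  have "left_int (2 - (a + b)) a b 0 = (\<lambda>x. 0)" by (simp add: left_int_def fun_eq_iff)
  then show ?case by (auto intro: exI[of _ 0])
next
  case (pCons c p)
  then obtain D where D: "(left_int (2 - (a + b)) a b p has_real_derivative D) (at x)" by auto
  note D1 = left_int_one_deriv[OF assms]
  have D2: "(left_int (2 - (a + b) + 1) a b p has_real_derivative
      (2 - (a + b)) * left_int (2 - (a + b)) a b p x) (at x)"
    using assms by (intro left_int_deriv) auto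
  let ?f = "\<lambda>x. c * left_int (2 - (a + b)) a b 1 x + x * left_int (2 - (a + b)) a b p x - left_int (2 - (a + b) + 1) a b p x"
  obtain E where "(?f has_real_derivative E) (at x)"
    using DERIV_diff[OF DERIV_add[OF DERIV_cmult[OF D1, of c] DERIV_mult[OF DERIV_ident D]] D2] by blast
  then have "(left_int (2 - (a + b)) a b (pCons c p) has_real_derivative E) (at x)"
    by (rule has_field_derivative_transform_within_open[where S = "{0<..<1}"])
      (use assms in \<open>auto simp: left_int_pCons\<close>)
  then show ?case by blast
qed

lemma reflected_integrand:
  "indicator {x<..<1} (1 + - 1 * t) *\<^sub>R ((1 + - 1 * t - x) powr (\<kappa> - 1) * (rho (a - 1) (b - 1) (1 + - 1 * t) * poly p (1 + - 1 * t)))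
     = indicator {0<..<1-x} t *\<^sub>R ((1 - x - t) powr (\<kappa> - 1) * (rho (b - 1) (a - 1) t * poly (p \<circ>\<^sub>p [:1, -1:]) t))"
  by (auto simp: indicator_def rho_def poly_pcompose algebra_simps)

text \<open>Transfers results from left integrals to right ones.\<close>

lemma right_int_reflect: "right_int \<kappa> a b p x = left_int \<kappa> b a (p \<circ>\<^sub>p [:1, -1:]) (1 - x)"
  using reflected_integrand[of x _ \<kappa> a b p]
  unfolding right_int_def left_int_def set_lebesgue_integral_def
  by (subst lborel_integral_real_affine[where c = "-1" and t = 1]) auto

lemma right_int_integrable:
  fixes \<kappa> a b x :: real
  assumes "0 < \<kappa>" "0 < a" "b \<le> 1" "0 < x" "x < 1"
  shows "set_integrable lborel {x<..<1} (\<lambda>t. (t - x) powr (\<kappa> - 1) * (rho (a - 1) (b - 1) t * poly p t))"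
  using left_int_integrable[of \<kappa> a b "1 - x" "p \<circ>\<^sub>p [:1, -1:]"] assms
    reflected_integrand[of x _ \<kappa> a b p]
  unfolding set_integrable_def
  by (subst lborel_integrable_real_affine_iff[where c = "-1" and t = 1, symmetric]) auto

lemma right_int_pCons:
  fixes \<kappa> a b x :: real
  assumes "0 < \<kappa>" "0 < a" "b \<le> 1" "0 < x" "x < 1"
  shows "right_int \<kappa> a b (pCons c p) x = c * right_int \<kappa> a b 1 x + x * right_int \<kappa> a b p x + right_int (\<kappa> + 1) a b p x"
proof -
  note I = right_int_integrable[OF assms] right_int_integrable[of "\<kappa> + 1" a b x]
  have "right_int \<kappa> a b (pCons c p) x = (LINT t:{x<..<1}|lborel.
      c * ((t - x) powr (\<kappa> - 1) * (rho (a - 1) (b - 1) t * poly 1 t))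
      + x * ((t - x) powr (\<kappa> - 1) * (rho (a - 1) (b - 1) t * poly p t))
      + (t - x) powr (\<kappa> + 1 - 1) * (rho (a - 1) (b - 1) t * poly p t))"
    unfolding right_int_def
  proof (rule set_lebesgue_integral_cong)
    have E: "(t - x) powr (\<kappa> + 1 - 1) = (t - x) * (t - x) powr (\<kappa> - 1)" if "x < t" for t
      using that by (simp add: powr_diff)
    then show "\<forall>t. t \<in> {x<..<1} \<longrightarrow> (t - x) powr (\<kappa> - 1) * (rho (a - 1) (b - 1) t * poly (pCons c p) t) =
        c * ((t - x) powr (\<kappa> - 1) * (rho (a - 1) (b - 1) t * poly 1 t))
      + x * ((t - x) powr (\<kappa> - 1) * (rho (a - 1) (b - 1) t * poly p t))
      + (t - x) powr (\<kappa> + 1 - 1) * (rho (a - 1) (b - 1) t * poly p t)"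
      by (auto simp only: E poly_pCons poly_1 greaterThanLessThan_iff) (simp_all add: algebra_simps)
  qed simp
  also have "\<dots> = c * right_int \<kappa> a b 1 x + x * right_int \<kappa> a b p x + right_int (\<kappa> + 1) a b p x"
    unfolding right_int_def using I assms
    by (simp only: set_integral_diff set_integral_add set_integrable_mult_right set_integral_mult_right
        add_pos_pos zero_less_one)
  finally show ?thesis .
qed

lemma reflect_deriv:
  fixes f :: "real \<Rightarrow> real"
  assumes "(f has_real_derivative D) (at (1 - x))"
  shows "((\<lambda>x. f (1 - x)) has_real_derivative - D) (at x)"
proof -
  have "((-) 1 has_real_derivative - 1) (at x)"
    by (auto intro!: derivative_eq_intros)
  from DERIV_chain2[OF assms this] show ?thesis by simp
qed

lemma right_int_deriv:
  fixes \<kappa> a b x :: real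
  assumes "0 < \<kappa>" "0 < a" "b \<le> 1" "0 < x" "x < 1"
  shows "(right_int (\<kappa> + 1) a b p has_real_derivative - (\<kappa> * right_int \<kappa> a b p x)) (at x)"
  unfolding right_int_reflect[abs_def] using assms by (intro reflect_deriv left_int_deriv) auto

lemma right_int_one_deriv:
  fixes a b x :: real
  assumes "0 < a" "b \<le> 1" "0 < b" "a + b < 2" "0 < x" "x < 1"
  shows "(right_int (2 - (a + b)) a b 1 has_real_derivative
           - (Gamma (2 - (a + b)) * Gamma a * rGamma (1 - b) * (x powr (- a) * (1 - x) powr (- b)))) (at x)"
proof -
  have "((1::real poly) \<circ>\<^sub>p [:1, -1:]) = 1" by (simp add: pcompose_1)
  then show ?thesis
    unfolding right_int_reflect[abs_def]
    using reflect_deriv[OF left_int_one_deriv[of b a "1 - x"]] assms by (simp add: add.commute mult_ac)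
qed

lemma right_int_differentiable:
  fixes a b x :: real
  assumes "0 < a" "b \<le> 1" "0 < b" "a + b < 2" "0 < x" "x < 1"
  shows "\<exists>D. (right_int (2 - (a + b)) a b p has_real_derivative D) (at x)"
  using left_int_differentiable[of b a "1 - x" "p \<circ>\<^sub>p [:1, -1:]"] assms
  unfolding right_int_reflect[abs_def] by (auto simp: add.commute intro: reflect_deriv)

lemma left_int_add:
  fixes \<kappa> a b x :: real
  assumes "0 < \<kappa>" "0 < b" "a \<le> 1" "0 < x" "x < 1"
  shows "left_int \<kappa> a b (p + q) x = left_int \<kappa> a b p x + left_int \<kappa> a b q x"
  using left_int_integrable[OF assms, of p] left_int_integrable[OF assms, of q]
  by (simp add: left_int_def distrib_left)

lemma left_int_smult: "left_int \<kappa> a b (smult c p) x = c * left_int \<kappa> a b p x"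
  unfolding left_int_def by (simp add: mult.left_commute[of _ c])

lemma right_int_add:
  fixes \<kappa> a b x :: real
  assumes "0 < \<kappa>" "0 < a" "b \<le> 1" "0 < x" "x < 1"
  shows "right_int \<kappa> a b (p + q) x = right_int \<kappa> a b p x + right_int \<kappa> a b q x"
  using assms by (simp add: right_int_reflect pcompose_add left_int_add)

lemma right_int_smult: "right_int \<kappa> a b (smult c p) x = c * right_int \<kappa> a b p x"
  by (simp add: right_int_reflect pcompose_smult left_int_smult)

lemma left_int_one_pos:
  fixes \<kappa> a b x :: real
  assumes "0 < \<kappa>" "0 < b" "a \<le> 1" "0 < x" "x < 1"
  shows "0 < left_int \<kappa> a b 1 x"
proof -
  have "0 < beta_series \<kappa> a b x"
    unfolding beta_series_def
  proof (rule suminf_pos2[where i = 0])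
    show "0 \<le> pow_coef a m * Beta (b + m) \<kappa> * x ^ m" for m
      using pow_coef_nonneg[of a m] Beta_pos[of "b + m" \<kappa>] assms by simp
    show "0 < pow_coef a 0 * Beta (b + real 0) \<kappa> * x ^ 0"
      using assms by (simp add: pow_coef_def Beta_pos)
  qed (use assms in \<open>auto intro: beta_series_summable\<close>)
  then show ?thesis using assms by (simp add: left_int_eq)
qed

lemma right_int_one_pos:
  fixes \<kappa> a b x :: real
  assumes "0 < \<kappa>" "0 < a" "b \<le> 1" "0 < x" "x < 1"
  shows "0 < right_int \<kappa> a b 1 x"
  using assms by (simp add: right_int_reflect pcompose_1 left_int_one_pos)

section \<open>Derivatives of weighted polynomials\<close>

lemma poly_antiderivative:
  fixes Q :: "real poly"
  obtains A where "pderiv A = Q" "\<And>k. coeff A (Suc k) = coeff Q k / (real k + 1)"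
proof
  define A where "A = (\<Sum>i\<le>degree Q. monom (coeff Q i / (real i + 1)) (Suc i))"
  show coeff_A: "coeff A (Suc k) = coeff Q k / (real k + 1)" for k
    by (auto simp: A_def coeff_sum if_distrib[of coeff] coeff_eq_0)
  show "pderiv A = Q"
    by (rule poly_eqI) (simp add: coeff_pderiv coeff_A add.commute)
qed

text \<open>The polynomial factor of the derivative of \<open>rho a b\<close> times \<open>p\<close>, after
  \<open>rho (a - 1) (b - 1)\<close> has been split off; see \<open>weighted_poly_deriv\<close>.\<close>

definition weighted_deriv :: "real \<Rightarrow> real \<Rightarrow> real poly \<Rightarrow> real poly" where
  "weighted_deriv a b p = [:0, 1, -1:] * pderiv p + [:b, - (a + b):] * p"

lemma weighted_deriv_add: "weighted_deriv a b (p + q) = weighted_deriv a b p + weighted_deriv a b q"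
  unfolding weighted_deriv_def pderiv_add by (simp only: distrib_left distrib_right ac_simps)

lemma weighted_deriv_smult: "weighted_deriv a b (smult c p) = smult c (weighted_deriv a b p)"
  by (simp add: weighted_deriv_def pderiv_smult algebra_simps smult_add_right)

lemma weighted_deriv_degree: "degree (weighted_deriv a b p) \<le> Suc (degree p)"
proof -
  have "degree ([:b, - (a + b):] * p) \<le> 1 + degree p"
    by (rule order_trans[OF degree_mult_le]) auto
  moreover have "degree ([:0, 1, -1:] * pderiv p) \<le> Suc (degree p)"
  proof (cases "degree p = 0")
    case True
    then have "pderiv p = 0" by (simp add: pderiv_eq_0_iff)
    then show ?thesis by simp
  next
    case False
    have "degree ([:0, 1, -1:] * pderiv p) \<le> 2 + (degree p - 1)"
      by (rule order_trans[OF degree_mult_le]) (simp add: degree_pderiv)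
    with False show ?thesis by simp
  qed
  ultimately show ?thesis unfolding weighted_deriv_def by (intro degree_add_le) auto
qed

lemma weighted_deriv_coeff:
  assumes "degree p \<le> n"
  shows "coeff (weighted_deriv a b p) (Suc n) = - (real n + (a + b)) * coeff p n"
  using assms by (cases n) (auto simp: weighted_deriv_def coeff_pderiv coeff_eq_0 algebra_simps coeff_pCons)

lemma rho_eq_lower: "0 < x \<Longrightarrow> x < 1 \<Longrightarrow> rho a b x = rho (a - 1) (b - 1) x * (x * (1 - x))"
  by (simp add: rho_def powr_diff)

lemma weighted_poly_deriv:
  fixes x :: real
  assumes "0 < x" "x < 1"
  shows "((\<lambda>x. rho a b x * poly p x) has_real_derivative rho (a - 1) (b - 1) x * poly (weighted_deriv a b p) x) (at x)"
proof -
  have 1: "((\<lambda>x. (1 - x) powr a * x powr b * poly p x) has_real_derivative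
     ((- (a * (1 - x) powr (a - 1)) * x powr b + (1 - x) powr a * (b * x powr (b - 1))) * poly p x
       + (1 - x) powr a * x powr b * poly (pderiv p) x)) (at x)"
    using assms by (auto intro!: derivative_eq_intros simp: algebra_simps)
  have 2: "(1 - x) powr a = (1 - x) * (1 - x) powr (a - 1)" "x powr b = x * x powr (b - 1)"
    using assms by (simp_all add: powr_diff)
  show ?thesis
    using 1 unfolding rho_def weighted_deriv_def by (simp add: 2 algebra_simps)
qed

section \<open>The balanced two-sided potential maps weighted polynomials to polynomials\<close>

text \<open>Here \<open>b\<close> is the exponent \<open>\<beta>\<close> of the boundary value problem and \<open>a = \<alpha> - \<beta>\<close>. The
  condition \<open>balance\<close> is the equation that determines \<open>\<beta>\<close> from \<open>r\<close>, freed of its denominator. It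
  is invariant under exchanging \<open>a, b\<close> and \<open>r, 1 - r\<close>, which is how the adjoint operator enters.\<close>

locale riesz_kernel =
  fixes a b r :: real
  assumes a: "0 < a" "a \<le> 1" and b: "0 < b" "b \<le> 1" and order: "1 < a + b" "a + b < 2"
    and r: "0 \<le> r" "r \<le> 1" and balance: "r * sin (pi * a) = (1 - r) * sin (pi * b)"
begin

text \<open>Up to a constant factor, the operator of the boundary value problem is the derivative of
  this potential, applied to the polynomial factor of \<open>D u\<close>.\<close>

definition potential :: "real poly \<Rightarrow> real \<Rightarrow> real" where
  "potential p x = r * left_int (2 - (a + b)) a b p x + (1 - r) * right_int (2 - (a + b)) a b p x"

lemma swap: "riesz_kernel b a (1 - r)"
  by unfold_locales (use a b order r balance in auto)

lemma potential_add: "0 < x \<Longrightarrow> x < 1 \<Longrightarrow> potential (p + q) x = potential p x + potential q x"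
  using a b order by (simp add: potential_def left_int_add right_int_add algebra_simps)

lemma potential_smult: "potential (smult c p) x = c * potential p x"
  by (simp add: potential_def left_int_smult right_int_smult algebra_simps)

text \<open>Both one-sided integrals of the weight have a multiple of
  \<open>x powr (- a) * (1 - x) powr (- b)\<close> as derivative, with opposite signs; the choice of \<open>b\<close> makes
  them cancel.\<close>

lemma potential_one_constant:
  assumes "0 < x" "x < 1"
  shows "potential 1 x = potential 1 (1/2)"
proof -
  (* The reflection formula rGamma (1 - c) = sin (pi c) Gamma c / pi turns the
     condition on r into the cancellation of the two derivatives. *)
  have cancel: "r * (Gamma b * rGamma (1 - a)) = (1 - r) * (Gamma a * rGamma (1 - b))"
  proof -
    have "rGamma (1 - c) = sin (pi * c) / pi * Gamma c" if "0 < c" for c :: real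
    proof -
      have "Complex.complex_of_real (rGamma c * rGamma (1 - c)) = of_real (sin (pi * c) / pi)"
        using rGamma_reflection_complex[of "of_real c"]
        by (simp add: rGamma_complex_of_real[symmetric] sin_of_real[symmetric] del: sin_of_real)
      then have "rGamma c * rGamma (1 - c) = sin (pi * c) / pi"
        by (simp only: of_real_eq_iff)
      moreover have "rGamma c * Gamma c = 1"
        using that by (simp add: rGamma_inverse_Gamma Gamma_real_pos less_imp_neq[symmetric])
      ultimately show ?thesis by (metis mult.assoc mult.commute mult.left_neutral)
    qed
    from this[OF a(1)] this[OF b(1)]
    have "r * (Gamma b * rGamma (1 - a)) = (r * sin (pi * a)) * (Gamma a * Gamma b / pi)"
      "(1 - r) * (Gamma a * rGamma (1 - b)) = ((1 - r) * sin (pi * b)) * (Gamma a * Gamma b / pi)"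
      by simp_all
    then show ?thesis by (simp only: balance)
  qed
  have "(potential 1 has_real_derivative 0) (at y within {0<..<1})" if "y \<in> {0<..<1}" for y
  proof -
    let ?w = "Gamma (2 - (a + b)) * (y powr (- a) * (1 - y) powr (- b))"
    have "(potential 1 has_real_derivative
       r * (Gamma (2 - (a + b)) * Gamma b * rGamma (1 - a) * (y powr (- a) * (1 - y) powr (- b)))
       + (1 - r) * (- (Gamma (2 - (a + b)) * Gamma a * rGamma (1 - b) * (y powr (- a) * (1 - y) powr (- b))))) (at y)"
      unfolding potential_def[abs_def] using that a b order
      by (intro DERIV_add DERIV_cmult left_int_one_deriv right_int_one_deriv) auto
    also have "r * (Gamma (2 - (a + b)) * Gamma b * rGamma (1 - a) * (y powr (- a) * (1 - y) powr (- b)))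
       + (1 - r) * (- (Gamma (2 - (a + b)) * Gamma a * rGamma (1 - b) * (y powr (- a) * (1 - y) powr (- b))))
       = ?w * (r * (Gamma b * rGamma (1 - a)) - (1 - r) * (Gamma a * rGamma (1 - b)))"
      by (simp add: algebra_simps)
    also have "\<dots> = 0" unfolding cancel by simp
    finally show ?thesis by (rule has_field_derivative_at_within)
  qed
  then have "\<exists>c. \<forall>y\<in>{0<..<1}. potential 1 y = c"
    by (intro has_field_derivative_zero_constant) auto
  then show ?thesis using assms by auto
qed

lemma potential_one_pos: "0 < potential 1 (1/2)"
proof -
  have "0 < left_int (2 - (a + b)) a b 1 (1/2)" "0 < right_int (2 - (a + b)) a b 1 (1/2)"
    using a b order by (auto intro!: left_int_one_pos right_int_one_pos)
  then show ?thesis using r unfolding potential_def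
    by (cases "r = 0") (auto intro!: add_pos_nonneg mult_pos_pos)
qed

text \<open>Let \<open>\<kappa> = 2 - (a + b)\<close>, and let \<open>U\<close> be the integral of the density of \<open>p\<close> against the kernel
  multiplied by \<open>x - t\<close>. If the potential of \<open>p\<close> is a polynomial \<open>Q\<close>, then so is \<open>U\<close>, since its
  derivative is \<open>\<kappa> Q\<close>; and as \<open>t = x - (x - t)\<close>, the potential of the polynomial \<open>x p(x)\<close> is
  \<open>x Q - U\<close>. For \<open>p\<close> of degree \<open>n\<close> this step multiplies the leading coefficient by
  \<open>1 - \<kappa> / (n + 1)\<close>, whence the Pochhammer symbol.\<close>

lemma potential_poly:
  "\<exists>Q. degree Q \<le> degree p \<and>
       coeff Q (degree p) = potential 1 (1/2) * (pochhammer (a + b - 1) (degree p) / fact (degree p)) * lead_coeff p \<and>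
       (\<forall>x. 0 < x \<longrightarrow> x < 1 \<longrightarrow> potential p x = poly Q x)"
proof (induction p)
  case 0
  show ?case using potential_smult[of 0 0] by (intro exI[of _ 0]) simp
next
  case (pCons c p)
  let ?\<kappa> = "2 - (a + b)"
  show ?case
  proof (cases "p = 0")
    case True
    have "[:c:] = smult c 1" by simp
    then have "potential [:c:] x = c * potential 1 (1/2)" if "0 < x" "x < 1" for x
      using potential_smult[of c 1 x] potential_one_constant[OF that] by metis
    then show ?thesis using True by (intro exI[of _ "[:c * potential 1 (1/2):]"]) simp
  next
    case False
    obtain Q where Q: "degree Q \<le> degree p"
      "coeff Q (degree p) = potential 1 (1/2) * (pochhammer (a + b - 1) (degree p) / fact (degree p)) * lead_coeff p"
      "\<And>x. 0 < x \<Longrightarrow> x < 1 \<Longrightarrow> potential p x = poly Q x"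
      using pCons.IH by blast
    obtain A where A: "pderiv A = Q" "\<And>k. coeff A (Suc k) = coeff Q k / (real k + 1)"
      using poly_antiderivative by blast
    define U where "U x = r * left_int (?\<kappa> + 1) a b p x - (1 - r) * right_int (?\<kappa> + 1) a b p x" for x
    have "((\<lambda>x. U x - ?\<kappa> * poly A x) has_real_derivative 0) (at x within {0<..<1})" if "x \<in> {0<..<1}" for x
    proof -
      have "((\<lambda>x. U x - ?\<kappa> * poly A x) has_real_derivative
          (r * (?\<kappa> * left_int ?\<kappa> a b p x) - (1 - r) * - (?\<kappa> * right_int ?\<kappa> a b p x)) - ?\<kappa> * poly (pderiv A) x) (at x)"
        unfolding U_def using that a b order
        by (intro DERIV_diff DERIV_cmult left_int_deriv right_int_deriv poly_DERIV) auto
      moreover have "(r * (?\<kappa> * left_int ?\<kappa> a b p x) - (1 - r) * - (?\<kappa> * right_int ?\<kappa> a b p x)) = ?\<kappa> * potential p x"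
        by (simp add: potential_def algebra_simps)
      ultimately show ?thesis using Q(3) A(1) that by (simp add: has_field_derivative_at_within)
    qed
    then obtain u where u: "\<And>x. x \<in> {0<..<1} \<Longrightarrow> U x - ?\<kappa> * poly A x = u"
      using has_field_derivative_zero_constant[of "{0<..<1}" "\<lambda>x. U x - ?\<kappa> * poly A x"] by auto
    define R where "R = [:c * potential 1 (1/2) - u:] + pCons 0 Q - smult ?\<kappa> A"
    have "potential (pCons c p) x = poly R x" if "0 < x" "x < 1" for x
    proof -
      have "potential (pCons c p) x = c * potential 1 x + x * potential p x - U x"
        using that a b order by (simp add: potential_def U_def left_int_pCons right_int_pCons algebra_simps)
      then show ?thesis using that u[of x] Q(3)[of x] potential_one_constant[of x]
        by (simp add: R_def)
    qed
    moreover have "degree R \<le> Suc (degree p)"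
    proof (rule degree_le, intro allI impI)
      fix i assume i: "Suc (degree p) < i"
      then obtain k where k: "i = Suc k" "degree p < k" by (cases i) auto
      then have "coeff Q k = 0" using Q(1) by (intro coeff_eq_0) auto
      then show "coeff R i = 0" using k A(2) by (simp add: R_def)
    qed
    moreover have "coeff R (Suc (degree p)) =
      potential 1 (1/2) * (pochhammer (a + b - 1) (Suc (degree p)) / fact (Suc (degree p))) * lead_coeff p"
    proof -
      let ?n = "real (degree p)"
      have "coeff R (Suc (degree p)) = coeff Q (degree p) * ((a + b - 1 + ?n) / (?n + 1))"
        by (simp add: R_def A(2) field_simps)
      also have "\<dots> = potential 1 (1/2) * (pochhammer (a + b - 1) (degree p) * (a + b - 1 + ?n)
          / (fact (degree p) * (?n + 1))) * lead_coeff p"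
        unfolding Q(2) by simp
      finally show ?thesis by (simp add: pochhammer_Suc mult_ac add_ac)
    qed
    ultimately show ?thesis using False by (intro exI[of _ R]) simp
  qed
qed

lemma potential_differentiable:
  assumes "0 < x" "x < 1"
  obtains L R where "(left_int (2 - (a + b)) a b p has_real_derivative L) (at x)"
    "(right_int (2 - (a + b)) a b p has_real_derivative R) (at x)"
  using left_int_differentiable[of a b x p] right_int_differentiable[of a b x p] assms a b order by auto

text \<open>The definition of the operator, with the inner derivative computed.\<close>

lemma frac_op_eq_deriv_potential:
  assumes x: "0 < x" "x < 1" and D: "(potential (weighted_deriv a b p) has_real_derivative D) (at x)"
  shows "frac_op r (a + b) (\<lambda>x. rho a b x * poly p x) x = - D / Gamma (2 - (a + b))"
proof -
  let ?u = "\<lambda>x. rho a b x * poly p x" and ?\<kappa> = "2 - (a + b)"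
  have u': "deriv ?u t = rho (a - 1) (b - 1) t * poly (weighted_deriv a b p) t" if "0 < t" "t < 1" for t
    using weighted_poly_deriv[OF that] by (rule DERIV_imp_deriv)
  have powr: "1 / y powr (a + b - 1) = y powr (?\<kappa> - 1)" for y
  proof -
    have "?\<kappa> - 1 = - (a + b - 1)" by simp
    then show ?thesis by (simp only: powr_minus_divide)
  qed
  have left: "(LINT t:{0<..<y}|lebesgue. 1 / (y - t) powr (a + b - 1) * deriv ?u t) = left_int ?\<kappa> a b (weighted_deriv a b p) y"
    if "y \<in> {0<..<1}" for y
  proof -
    have "(LINT t:{0<..<y}|lebesgue. 1 / (y - t) powr (a + b - 1) * deriv ?u t)
       = (LINT t:{0<..<y}|lebesgue. (y - t) powr (?\<kappa> - 1) * (rho (a - 1) (b - 1) t * poly (weighted_deriv a b p) t))"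
      using that by (intro set_lebesgue_integral_cong) (auto simp: u' powr)
    then show ?thesis
      unfolding left_int_def set_lebesgue_integral_def rho_def
      by (subst (asm) (2) integral_completion) measurable
  qed
  have right: "(LINT t:{y<..<1}|lebesgue. 1 / (t - y) powr (a + b - 1) * deriv ?u t) = right_int ?\<kappa> a b (weighted_deriv a b p) y"
    if "y \<in> {0<..<1}" for y
  proof -
    have "(LINT t:{y<..<1}|lebesgue. 1 / (t - y) powr (a + b - 1) * deriv ?u t)
       = (LINT t:{y<..<1}|lebesgue. (t - y) powr (?\<kappa> - 1) * (rho (a - 1) (b - 1) t * poly (weighted_deriv a b p) t))"
      using that by (intro set_lebesgue_integral_cong) (auto simp: u' powr)
    then show ?thesis
      unfolding right_int_def set_lebesgue_integral_def rho_def
      by (subst (asm) (2) integral_completion) measurable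
  qed
  obtain L R where L: "(left_int ?\<kappa> a b (weighted_deriv a b p) has_real_derivative L) (at x)"
    and R: "(right_int ?\<kappa> a b (weighted_deriv a b p) has_real_derivative R) (at x)"
    using potential_differentiable[OF x] by blast
  have "((\<lambda>y. 1 / Gamma ?\<kappa> * (LINT t:{0<..<y}|lebesgue. 1 / (y - t) powr (a + b - 1) * deriv ?u t))
      has_real_derivative 1 / Gamma ?\<kappa> * L) (at x)"
    by (rule has_field_derivative_transform_within_open[OF DERIV_cmult[OF L], where S = "{0<..<1}"])
      (use x left in auto)
  then have fl: "frac_left (a + b) ?u x = 1 / Gamma ?\<kappa> * L"
    unfolding frac_left_def by (rule DERIV_imp_deriv)
  have "((\<lambda>y. 1 / Gamma ?\<kappa> * (LINT t:{y<..<1}|lebesgue. 1 / (t - y) powr (a + b - 1) * deriv ?u t))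
      has_real_derivative 1 / Gamma ?\<kappa> * R) (at x)"
    by (rule has_field_derivative_transform_within_open[OF DERIV_cmult[OF R], where S = "{0<..<1}"])
      (use x right in auto)
  then have fr: "frac_right (a + b) ?u x = 1 / Gamma ?\<kappa> * R"
    unfolding frac_right_def by (rule DERIV_imp_deriv)
  have "(potential (weighted_deriv a b p) has_real_derivative r * L + (1 - r) * R) (at x)"
    unfolding potential_def[abs_def] by (intro DERIV_add DERIV_cmult L R)
  then have "D = r * L + (1 - r) * R" using D by (rule DERIV_unique[symmetric])
  then show ?thesis by (simp add: frac_op_def fl fr add_divide_distrib diff_divide_distrib)
qed

end

section \<open>Adjointness of the potential\<close>

lemma poly_bounded_unit: "\<exists>M. \<forall>x\<in>{0..1}. \<bar>poly p x\<bar> \<le> (M::real)"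
proof -
  have "compact (poly p ` {0..1})"
    by (intro compact_continuous_image continuous_intros) auto
  then have "bounded (poly p ` {0..1})" by (rule compact_imp_bounded)
  then show ?thesis by (auto simp: bounded_iff)
qed

lemma rho_poly_integrable:
  fixes a b :: real
  assumes "-1 < a" "-1 < b"
  shows "set_integrable lborel {0<..<1} (\<lambda>x. rho a b x * poly p x)"
proof -
  obtain M where M: "\<And>x. x \<in> {0..1} \<Longrightarrow> \<bar>poly p x\<bar> \<le> M" using poly_bounded_unit[of p] by blast
  have "set_integrable lborel {0..1} (\<lambda>x. x powr (b + 1 - 1) * (1 - x) powr (a + 1 - 1))"
    by (rule integrable_Beta) (use assms in auto)
  then have "set_integrable lborel {0<..<1} (\<lambda>x. x powr (b + 1 - 1) * (1 - x) powr (a + 1 - 1))"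
    by (rule set_integrable_subset) auto
  then have "set_integrable lborel {0<..<1} (\<lambda>x. M * rho a b x)"
    by (intro set_integrable_mult_right) (simp add: rho_def mult.commute)
  then show ?thesis
  proof (rule set_integrable_bound)
    show "set_borel_measurable lborel {0<..<1} (\<lambda>x. rho a b x * poly p x)"
      unfolding set_borel_measurable_def by measurable
    show "AE x in lborel. x \<in> {0<..<1} \<longrightarrow> norm (rho a b x * poly p x) \<le> norm (M * rho a b x)"
    proof (intro AE_I2 impI)
      fix x :: real assume "x \<in> {0<..<1}"
      then have "\<bar>poly p x\<bar> \<le> M" "0 \<le> rho a b x" using M[of x] by (auto simp: rho_def)
      moreover from this have "\<bar>poly p x\<bar> * rho a b x \<le> M * rho a b x" by (intro mult_right_mono)
      ultimately show "norm (rho a b x * poly p x) \<le> norm (M * rho a b x)"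
        by (simp add: abs_mult mult.commute)
    qed
  qed
qed

lemma weighted_poly_deriv_integral:
  fixes a b :: real
  assumes "0 < a" "0 < b"
  shows "(LINT x:{0<..<1}|lborel. rho (a - 1) (b - 1) x * poly (weighted_deriv a b p) x) = 0"
proof -
  have I: "set_integrable lborel {0<..<1} (\<lambda>x. rho (a - 1) (b - 1) x * poly (weighted_deriv a b p) x)"
    by (rule rho_poly_integrable) (use assms in auto)
  have "continuous_on {0..1} (\<lambda>x. rho a b x * poly p x)"
    unfolding rho_def using assms
    by (intro continuous_intros continuous_on_powr') auto
  then have "((\<lambda>x. rho (a - 1) (b - 1) x * poly (weighted_deriv a b p) x) has_integral
      rho a b 1 * poly p 1 - rho a b 0 * poly p 0) {0..1}"
    by (intro fundamental_theorem_of_calculus_interior)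
      (auto simp: has_real_derivative_iff_has_vector_derivative[symmetric] weighted_poly_deriv)
  then have "((\<lambda>x. rho (a - 1) (b - 1) x * poly (weighted_deriv a b p) x) has_integral 0) {0<..<1}"
    using assms by (simp add: has_integral_Icc_iff_Ioo rho_def)
  then show ?thesis
    using set_borel_integral_eq_integral(2)[OF I] by (simp add: integral_unique)
qed

text \<open>The boundary terms vanish because both exponents of \<open>rho a b\<close> are positive.\<close>

lemma weighted_integration_by_parts:
  fixes a b :: real
  assumes "0 < a" "0 < b"
  shows "(LINT x:{0<..<1}|lborel. rho a b x * poly (pderiv p * q) x)
    = - (LINT x:{0<..<1}|lborel. rho (a - 1) (b - 1) x * poly (p * weighted_deriv a b q) x)"
proof -
  have "weighted_deriv a b (p * q) = [:0, 1, -1:] * (pderiv p * q) + p * weighted_deriv a b q"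
    unfolding weighted_deriv_def pderiv_mult by (simp only: distrib_left distrib_right ac_simps)
  moreover have "rho (a - 1) (b - 1) x * poly ([:0, 1, -1:] * u) x = rho a b x * poly u x"
    if "x \<in> {0<..<1}" for u x
    using that by (simp add: rho_eq_lower[of x a b] algebra_simps)
  ultimately have "rho (a - 1) (b - 1) x * poly (weighted_deriv a b (p * q)) x
     = rho a b x * poly (pderiv p * q) x + rho (a - 1) (b - 1) x * poly (p * weighted_deriv a b q) x"
    if "x \<in> {0<..<1}" for x
    using that by (simp only: poly_add distrib_left)
  then have "(LINT x:{0<..<1}|lborel. rho (a - 1) (b - 1) x * poly (weighted_deriv a b (p * q)) x)
    = (LINT x:{0<..<1}|lborel. rho a b x * poly (pderiv p * q) x + rho (a - 1) (b - 1) x * poly (p * weighted_deriv a b q) x)"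
    by (intro set_lebesgue_integral_cong) auto
  also have "\<dots> = (LINT x:{0<..<1}|lborel. rho a b x * poly (pderiv p * q) x)
      + (LINT x:{0<..<1}|lborel. rho (a - 1) (b - 1) x * poly (p * weighted_deriv a b q) x)"
    using assms by (intro set_integral_add rho_poly_integrable) auto
  finally show ?thesis using weighted_poly_deriv_integral[OF assms] by simp
qed

context riesz_kernel
begin

definition kernel :: "real \<Rightarrow> real" where
  "kernel y = (if 0 < y then r * y powr (2 - (a + b) - 1) else (1 - r) * (- y) powr (2 - (a + b) - 1))"

lemma kernel_measurable [measurable]: "kernel \<in> borel_measurable borel"
  unfolding kernel_def[abs_def] by measurable

lemma kernel_nonneg: "0 \<le> kernel y"
  using r by (simp add: kernel_def)

lemma kernel_swap: "riesz_kernel.kernel b a (1 - r) y = kernel (- y)"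
proof -
  interpret swapped: riesz_kernel b a "1 - r" by (rule swap)
  show ?thesis by (cases "y = 0") (auto simp: kernel_def swapped.kernel_def add.commute)
qed

lemma potential_has_bochner_integral:
  assumes x: "0 < x" "x < 1"
  shows "has_bochner_integral lborel
    (\<lambda>t. kernel (x - t) * (indicator {0<..<1} t * (rho (a - 1) (b - 1) t * poly p t))) (potential p x)"
proof -
  let ?\<kappa> = "2 - (a + b)"
  have split: "kernel (x - t) * (indicator {0<..<1} t * (rho (a - 1) (b - 1) t * poly p t))
    = r * (indicator {0<..<x} t *\<^sub>R ((x - t) powr (?\<kappa> - 1) * (rho (a - 1) (b - 1) t * poly p t)))
      + (1 - r) * (indicator {x<..<1} t *\<^sub>R ((t - x) powr (?\<kappa> - 1) * (rho (a - 1) (b - 1) t * poly p t)))" for t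
    using x by (cases "t = x") (auto simp: kernel_def indicator_def)
  have "set_integrable lborel {0<..<x} (\<lambda>t. (x - t) powr (?\<kappa> - 1) * (rho (a - 1) (b - 1) t * poly p t))"
    "set_integrable lborel {x<..<1} (\<lambda>t. (t - x) powr (?\<kappa> - 1) * (rho (a - 1) (b - 1) t * poly p t))"
    using x a b order by (intro left_int_integrable right_int_integrable; simp)+
  then show ?thesis
    unfolding split potential_def left_int_def right_int_def set_integrable_def set_lebesgue_integral_def
    by (intro has_bochner_integral_add has_bochner_integral_mult_right has_bochner_integral_integrable)
qed

text \<open>Transposing the kernel exchanges the roles of \<open>r\<close> and \<open>1 - r\<close>. The only analytic point is
  the absolute integrability that Fubini's theorem requires.\<close>

lemma potential_adjoint:
  "(LINT x:{0<..<1}|lborel. rho (b - 1) (a - 1) x * poly q x * potential p x)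
   = (LINT t:{0<..<1}|lborel. rho (a - 1) (b - 1) t * poly p t * riesz_kernel.potential b a (1 - r) q t)"
proof -
  interpret swapped: riesz_kernel b a "1 - r" by (rule swap)
  define W where "W p t = indicator {0<..<1} t * (rho (a - 1) (b - 1) t * poly p t)" for p and t :: real
  define V where "V p t = indicator {0<..<1} t * (rho (b - 1) (a - 1) t * poly p t)" for p and t :: real
  define F where "F p q = (\<lambda>(x, t). kernel (x - t) * W p t * V q x)" for p q
  have [measurable]: "W p \<in> borel_measurable borel" "V p \<in> borel_measurable borel" for p
    unfolding W_def[abs_def] V_def[abs_def] by measurable
  have F_measurable [measurable]: "F p q \<in> borel_measurable (lborel \<Otimes>\<^sub>M lborel)" for p q
    unfolding F_def by measurable
  have inner: "has_bochner_integral lborel (\<lambda>t. F p q (x, t)) (V q x * potential p x)" for p q x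
  proof (cases "x \<in> {0<..<1}")
    case True
    then show ?thesis
      using has_bochner_integral_mult_left[OF potential_has_bochner_integral[of x p], of "V q x"]
      by (simp add: F_def W_def mult_ac)
  qed (auto simp: F_def V_def has_bochner_integral_zero)
  have outer: "has_bochner_integral lborel (\<lambda>x. F p q (x, t)) (W p t * swapped.potential q t)" for p q t
  proof (cases "t \<in> {0<..<1}")
    case True
    then show ?thesis
      using has_bochner_integral_mult_left[OF swapped.potential_has_bochner_integral[of t q], of "W p t"]
      by (simp add: F_def V_def kernel_swap mult_ac)
  qed (auto simp: F_def W_def has_bochner_integral_zero)
  (* For p = q = 1 the integrand is nonnegative and its inner integral is a constant
     times the outer weight, so Tonelli applies; for other polynomials it is a bounded multiple of this one. *)
  have base: "integrable (lborel \<Otimes>\<^sub>M lborel) (F 1 1)"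
  proof (rule lborel_pair.Fubini_integrable)
    show "F 1 1 \<in> borel_measurable (lborel \<Otimes>\<^sub>M lborel)" by simp
    have nn: "norm (F 1 1 (x, t)) = F 1 1 (x, t)" for x t
      using kernel_nonneg[of "x - t"] by (simp add: F_def W_def V_def rho_def indicator_def)
    have "V 1 x * potential 1 x = potential 1 (1/2) * V 1 x" for x
      using potential_one_constant[of x] by (cases "x \<in> {0<..<1}") (auto simp: V_def)
    then have "(\<integral>t. F 1 1 (x, t) \<partial>lborel) = potential 1 (1/2) * V 1 x" for x
      using inner[of 1 1 x] by (auto simp only: has_bochner_integral_iff)
    moreover have "integrable lborel (V 1)"
      using rho_poly_integrable[of "b - 1" "a - 1" 1] a b
      by (simp add: set_integrable_def V_def[abs_def])
    ultimately show "integrable lborel (\<lambda>x. \<integral>t. norm (F 1 1 (x, t)) \<partial>lborel)"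
      unfolding nn by simp
    show "AE x in lborel. integrable lborel (\<lambda>t. F 1 1 (x, t))"
      using inner by (auto simp: has_bochner_integral_iff)
  qed
  obtain M where M: "\<And>x. x \<in> {0..1} \<Longrightarrow> \<bar>poly p x\<bar> \<le> M" using poly_bounded_unit[of p] by blast
  obtain N where N: "\<And>x. x \<in> {0..1} \<Longrightarrow> \<bar>poly q x\<bar> \<le> N" using poly_bounded_unit[of q] by blast
  have "integrable (lborel \<Otimes>\<^sub>M lborel) (F p q)"
  proof (rule Bochner_Integration.integrable_bound)
    show "integrable (lborel \<Otimes>\<^sub>M lborel) (\<lambda>z. (M * N) * F 1 1 z)"
      using base by (rule integrable_mult_right)
    have "norm (F p q (x, t)) \<le> norm (M * N * F 1 1 (x, t))" for x t
    proof (cases "x \<in> {0<..<1} \<and> t \<in> {0<..<1}")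
      case True
      then have "\<bar>poly p t\<bar> \<le> M" "\<bar>poly q x\<bar> \<le> N" using M[of t] N[of x] by auto
      then have "\<bar>poly p t\<bar> * \<bar>poly q x\<bar> \<le> M * N" by (intro mult_mono) auto
      moreover have "F p q (x, t) = F 1 1 (x, t) * (poly p t * poly q x)"
        by (simp add: F_def W_def V_def mult_ac)
      ultimately show ?thesis
        using mult_left_mono[OF order_trans[OF _ abs_ge_self], of "\<bar>poly p t\<bar> * \<bar>poly q x\<bar>" "M * N" "\<bar>F 1 1 (x, t)\<bar>"]
        by (simp only: real_norm_def abs_mult mult_ac abs_ge_zero simp_thms)
    qed (auto simp: F_def W_def V_def)
    then show "AE z in lborel \<Otimes>\<^sub>M lborel. norm (F p q z) \<le> norm (M * N * F 1 1 z)"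
      by (intro AE_I2) auto
  qed simp
  then have "integrable (lborel \<Otimes>\<^sub>M lborel) (case_prod (\<lambda>x t. F p q (x, t)))" by simp
  from lborel_pair.Fubini_integral[OF this]
  have "(\<integral>t. (\<integral>x. F p q (x, t) \<partial>lborel) \<partial>lborel) = (\<integral>x. (\<integral>t. F p q (x, t) \<partial>lborel) \<partial>lborel)" .
  then have "(\<integral>t. W p t * swapped.potential q t \<partial>lborel) = (\<integral>x. V q x * potential p x \<partial>lborel)"
    using inner[of p q] outer[of p q] by (simp add: has_bochner_integral_iff)
  then show ?thesis by (simp add: set_lebesgue_integral_def W_def V_def mult_ac)
qed

text \<open>The eigenvalues of the operator between the two Jacobi bases. At this stage they are just
  the factors by which the operator multiplies leading coefficients.\<close>

definition eigval :: "nat \<Rightarrow> real" where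
  "eigval n = potential 1 (1/2) * (a + b - 1) / Gamma (2 - (a + b)) * (pochhammer (a + b) (Suc n) / fact n)"

lemma eigval_pos: "0 < eigval n"
  unfolding eigval_def using potential_one_pos order
  by (intro mult_pos_pos divide_pos_pos pochhammer_pos) (auto simp: Gamma_real_pos)

text \<open>Triangularity of the operator. The auxiliary polynomial \<open>R\<close> is kept in the statement because
  the adjointness argument needs the potential before its differentiation.\<close>

lemma frac_op_poly:
  obtains Q R where
    "\<And>x. 0 < x \<Longrightarrow> x < 1 \<Longrightarrow> frac_op r (a + b) (\<lambda>x. rho a b x * poly p x) x = poly Q x"
    "degree Q \<le> degree p"
    "coeff Q (degree p) = eigval (degree p) * lead_coeff p"
    "Q = smult (- 1 / Gamma (2 - (a + b))) (pderiv R)"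
    "\<And>x. 0 < x \<Longrightarrow> x < 1 \<Longrightarrow> potential (weighted_deriv a b p) x = poly R x"
proof -
  let ?G = "Gamma (2 - (a + b))" and ?n = "degree p"
  obtain R where R: "degree R \<le> degree (weighted_deriv a b p)"
      "coeff R (degree (weighted_deriv a b p)) = potential 1 (1/2) * (pochhammer (a + b - 1) (degree (weighted_deriv a b p))
        / fact (degree (weighted_deriv a b p))) * lead_coeff (weighted_deriv a b p)"
      "\<And>x. 0 < x \<Longrightarrow> x < 1 \<Longrightarrow> potential (weighted_deriv a b p) x = poly R x"
    using potential_poly[of "weighted_deriv a b p"] by blast
  have lead: "coeff R (Suc ?n) = potential 1 (1/2) * (pochhammer (a + b - 1) (Suc ?n) / fact (Suc ?n)) * coeff (weighted_deriv a b p) (Suc ?n)"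
  proof (cases "degree (weighted_deriv a b p) = Suc ?n")
    case False
    then have "degree (weighted_deriv a b p) < Suc ?n" using weighted_deriv_degree[of a b p] by simp
    then show ?thesis using R(1) by (simp add: coeff_eq_0)
  qed (use R(2) in simp)
  define Q where "Q = smult (- 1 / ?G) (pderiv R)"
  have "frac_op r (a + b) (\<lambda>x. rho a b x * poly p x) x = poly Q x" if x: "0 < x" "x < 1" for x
  proof -
    have "(potential (weighted_deriv a b p) has_real_derivative poly (pderiv R) x) (at x)"
      by (rule has_field_derivative_transform_within_open[OF poly_DERIV, where S = "{0<..<1}"])
        (use x R(3) in auto)
    from frac_op_eq_deriv_potential[OF x this] show ?thesis by (simp add: Q_def)
  qed
  moreover have "degree Q \<le> ?n"
  proof -
    have "degree Q \<le> degree R - 1"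
      using degree_smult_le[of "- 1 / ?G" "pderiv R"] by (simp add: Q_def degree_pderiv)
    also have "\<dots> \<le> ?n" using R(1) weighted_deriv_degree[of a b p] by simp
    finally show ?thesis .
  qed
  moreover have "coeff Q ?n = eigval ?n * lead_coeff p"
  proof -
    have "pochhammer (a + b - 1) (Suc ?n) * (real ?n + (a + b)) = (a + b - 1) * pochhammer (a + b) (Suc ?n)"
      using pochhammer_rec[of "a + b - 1" ?n] pochhammer_Suc[of "a + b" ?n]
      by (simp add: mult.assoc add.commute)
    then have "(a + b - 1) * pochhammer (a + b) (Suc ?n) = pochhammer (a + b - 1) (Suc ?n) * (real ?n + (a + b))" ..
    then have S: "eigval ?n = potential 1 (1/2) * (pochhammer (a + b - 1) (Suc ?n) * (real ?n + (a + b))) / ?G / fact ?n"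
      by (simp add: eigval_def mult.assoc)
    have f: "fact (Suc ?n) = (real ?n + 1) * fact ?n" by (simp add: algebra_simps)
    have nz: "real ?n + 1 \<noteq> 0" by linarith
    have arith: "- N * (j * (P / (N * F)) * (- M * l)) / G' = j * (P * M) / G' / F * l"
      if "N \<noteq> 0" for N j P F M l G' :: real
      using that by (simp add: mult.assoc mult.commute[of G'])
    have "coeff Q ?n = - (real ?n + 1) * coeff R (Suc ?n) / ?G"
      by (simp add: Q_def coeff_pderiv algebra_simps add_divide_distrib diff_divide_distrib)
    also have "\<dots> = eigval ?n * lead_coeff p"
      unfolding lead weighted_deriv_coeff[OF order_refl] S f by (rule arith[OF nz])
    finally show ?thesis .
  qed
  ultimately show ?thesis using that R(3) Q_def by blast
qed

end

section \<open>Orthogonality of the Jacobi polynomials\<close>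

text \<open>The polynomial behind the function \<open>G a b n\<close>, so that degrees and coefficients are available.\<close>

definition Gpoly :: "real \<Rightarrow> real \<Rightarrow> nat \<Rightarrow> real poly" where
  "Gpoly a b n = (\<Sum>m\<le>n. smult (((real n + a) gchoose m) * ((real n + b) gchoose (n - m)))
                             ([:-1, 1:] ^ (n - m) * [:0, 1:] ^ m))"

lemma poly_Gpoly: "poly (Gpoly a b n) x = G a b n x"
proof -
  have half: "(2 * x - 1 - 1) / 2 = x - 1" "(2 * x - 1 + 1) / 2 = x" by (simp_all add: field_simps)
  show ?thesis
    unfolding G_def jacobi_def half by (simp add: Gpoly_def poly_sum mult.assoc)
qed

lemma coeff_jacobi_factor:
  assumes "m \<le> n"
  shows "degree ([:-1, 1::real:] ^ (n - m) * [:0, 1:] ^ m) = n"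
    and "coeff ([:-1, 1::real:] ^ (n - m) * [:0, 1:] ^ m) n = 1"
proof -
  show d: "degree ([:-1, 1::real:] ^ (n - m) * [:0, 1:] ^ m) = n"
    using assms by (simp add: degree_mult_eq degree_power_eq)
  have "lead_coeff ([:-1, 1::real:] ^ (n - m) * [:0, 1:] ^ m) = 1"
    by (simp add: lead_coeff_mult lead_coeff_power)
  then show "coeff ([:-1, 1::real:] ^ (n - m) * [:0, 1:] ^ m) n = 1" unfolding d .
qed

lemma degree_Gpoly_le: "degree (Gpoly a b n) \<le> n"
  unfolding Gpoly_def
  by (intro degree_sum_le) (auto intro: order_trans[OF degree_smult_le] simp: coeff_jacobi_factor)

lemma coeff_Gpoly: "coeff (Gpoly a b n) n = (\<Sum>m\<le>n. ((real n + a) gchoose m) * ((real n + b) gchoose (n - m)))"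
  by (simp add: Gpoly_def coeff_sum coeff_jacobi_factor)

lemma coeff_Gpoly_swap: "coeff (Gpoly a b n) n = coeff (Gpoly b a n) n"
  unfolding coeff_Gpoly
  by (rule sum.reindex_bij_witness[of _ "\<lambda>m. n - m" "\<lambda>m. n - m"]) auto

lemma G_reflect: "G a b n (1 - x) = (-1) ^ n * G b a n x"
proof -
  have "G a b n (1 - x) = (\<Sum>m\<le>n. ((real n + a) gchoose (n - m)) * ((real n + b) gchoose m) * (- x) ^ m * (1 - x) ^ (n - m))"
    unfolding poly_Gpoly[symmetric] Gpoly_def poly_sum
    by (rule sum.reindex_bij_witness[of _ "\<lambda>m. n - m" "\<lambda>m. n - m"]) (auto simp: mult_ac)
  also have "\<dots> = (\<Sum>m\<le>n. (-1) ^ n * (((real n + b) gchoose m) * ((real n + a) gchoose (n - m)) * (x - 1) ^ (n - m) * x ^ m))"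
  proof (rule sum.cong[OF refl])
    fix m assume "m \<in> {..n}"
    then have "(-1::real) ^ n = (-1) ^ m * (-1) ^ (n - m)" by (simp add: power_add[symmetric])
    moreover have "(1 - x) ^ (n - m) = (-1) ^ (n - m) * (x - 1) ^ (n - m)"
      by (simp flip: power_mult_distrib)
    moreover have "(-1::real) ^ (n - m) * (-1) ^ (n - m) = 1" by (simp flip: power_mult_distrib)
    ultimately show "((real n + a) gchoose (n - m)) * ((real n + b) gchoose m) * (- x) ^ m * (1 - x) ^ (n - m) =
      (-1) ^ n * (((real n + b) gchoose m) * ((real n + a) gchoose (n - m)) * (x - 1) ^ (n - m) * x ^ m)"
      by (simp add: power_minus[of x] mult_ac)
  qed
  also have "\<dots> = (-1) ^ n * G b a n x"
    unfolding poly_Gpoly[symmetric] Gpoly_def poly_sum by (simp add: sum_distrib_left mult_ac)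
  finally show ?thesis .
qed

lemma gchoose_pos:
  assumes "-1 < c" "m \<le> n"
  shows "0 < (real n + c) gchoose m"
  using assms by (simp add: gbinomial_pochhammer' pochhammer_pos)

lemma coeff_Gpoly_pos:
  assumes "-1 < a" "-1 < b"
  shows "0 < coeff (Gpoly a b n) n"
  unfolding coeff_Gpoly using assms by (intro sum_pos mult_pos_pos gchoose_pos) auto

lemma degree_Gpoly:
  assumes "-1 < a" "-1 < b"
  shows "degree (Gpoly a b n) = n"
  using coeff_Gpoly_pos[OF assms, of n] degree_Gpoly_le[of a b n] le_degree[of "Gpoly a b n" n]
  by linarith

lemma alternating_binomial_sum_Suc:
  fixes f :: "nat \<Rightarrow> real"
  shows "(\<Sum>m\<le>Suc n. (-1) ^ m * real (Suc n choose m) * f m)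
       = (\<Sum>m\<le>n. (-1) ^ m * real (n choose m) * (f m - f (Suc m)))"
proof -
  have "(\<Sum>m\<le>n. (-1) ^ m * real (n choose m) * f m) = (\<Sum>m\<le>Suc n. (-1) ^ m * real (n choose m) * f m)"
    by simp
  also have "\<dots> = f 0 + (\<Sum>m\<le>n. (-1) ^ Suc m * real (n choose Suc m) * f (Suc m))"
    by (subst sum.atMost_Suc_shift) simp
  finally show ?thesis
    by (subst sum.atMost_Suc_shift) (simp add: sum.distrib sum_subtractf sum_negf algebra_simps)
qed

text \<open>The sum is an \<open>n\<close>-th finite difference of a polynomial of degree \<open>i < n\<close>. A single
  difference lowers the degree of a Pochhammer polynomial by one, so induction applies.\<close>

lemma alternating_pochhammer_sum:
  fixes c :: real
  assumes "i < n"
  shows "(\<Sum>m\<le>n. (-1) ^ m * real (n choose m) * pochhammer (c + m) i) = 0"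
  using assms
proof (induction n arbitrary: i c)
  case (Suc n)
  show ?case
  proof (cases i)
    case 0
    then show ?thesis by (simp only: alternating_binomial_sum_Suc) simp
  next
    case (Suc j)
    have "pochhammer (c + m) (Suc j) - pochhammer (c + Suc m) (Suc j) = - (real j + 1) * pochhammer ((c + 1) + m) j" for m
      using pochhammer_rec[of "c + m" j] pochhammer_Suc[of "c + Suc m" j] by (simp add: algebra_simps)
    then have "(\<Sum>m\<le>Suc n. (-1) ^ m * real (Suc n choose m) * pochhammer (c + m) i)
      = - (real j + 1) * (\<Sum>m\<le>n. (-1) ^ m * real (n choose m) * pochhammer ((c + 1) + m) j)"
      unfolding alternating_binomial_sum_Suc Suc by (simp only: sum_distrib_left mult_ac)
    then show ?thesis using Suc.IH[of j "c + 1"] Suc.prems Suc by simp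
  qed
qed simp

lemma rho_monomial_integral:
  fixes a b :: real
  assumes "-1 < a" "-1 < b"
  shows "(LINT x:{0<..<1}|lborel. rho a b x * ((1 - x) ^ k * x ^ l)) = Beta (b + l + 1) (a + k + 1)"
proof -
  have eq: "rho a b x * ((1 - x) ^ k * x ^ l) = x powr (b + l + 1 - 1) * (1 - x) powr (a + k + 1 - 1)"
    if "x \<in> {0<..<1}" for x
    using that by (simp add: rho_def powr_realpow[symmetric] powr_add)
  have I: "set_integrable lborel {0<..<1} (\<lambda>x. x powr (b + l + 1 - 1) * (1 - x) powr (a + k + 1 - 1))"
    by (rule set_integrable_subset[OF integrable_Beta]) (use assms in auto)
  have "((\<lambda>x. x powr (b + l + 1 - 1) * (1 - x) powr (a + k + 1 - 1)) has_integral Beta (b + l + 1) (a + k + 1)) {0<..<1}"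
    using has_integral_Beta_real[of "b + l + 1" "a + k + 1"] assms by (simp add: has_integral_Icc_iff_Ioo)
  then have "(LINT x:{0<..<1}|lborel. x powr (b + l + 1 - 1) * (1 - x) powr (a + k + 1 - 1)) = Beta (b + l + 1) (a + k + 1)"
    using set_borel_integral_eq_integral(2)[OF I] by (simp add: integral_unique)
  moreover have "(LINT x:{0<..<1}|lborel. rho a b x * ((1 - x) ^ k * x ^ l))
    = (LINT x:{0<..<1}|lborel. x powr (b + l + 1 - 1) * (1 - x) powr (a + k + 1 - 1))"
    by (rule set_lebesgue_integral_cong) (use eq in auto)
  ultimately show ?thesis by simp
qed

lemma set_integral_lincomb:
  fixes c :: "'i \<Rightarrow> real"
  assumes "\<And>i. set_integrable M A (f i)"
  shows "(LINT x:A|M. \<Sum>i\<in>I. c i * f i x) = (\<Sum>i\<in>I. c i * (LINT x:A|M. f i x))"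
proof -
  have "(LINT x:A|M. \<Sum>i\<in>I. c i * f i x) = (\<integral>x. (\<Sum>i\<in>I. c i * (indicator A x *\<^sub>R f i x)) \<partial>M)"
    unfolding set_lebesgue_integral_def scaleR_sum_right by (simp only: real_scaleR_def mult.left_commute)
  also have "\<dots> = (\<Sum>i\<in>I. c i * (LINT x:A|M. f i x))"
    using assms unfolding set_lebesgue_integral_def set_integrable_def
    by (subst Bochner_Integration.integral_sum) auto
  finally show ?thesis .
qed

text \<open>Integrating the defining sum against \<open>x ^ i\<close> gives Beta values. After cancellation of the Gamma
  factors what remains is the alternating binomial sum of \<open>alternating_pochhammer_sum\<close>.\<close>

lemma Gpoly_orthogonal_monomial:
  fixes a b :: real
  assumes ab: "-1 < a" "-1 < b" and "i < n"
  shows "(LINT x:{0<..<1}|lborel. rho a b x * (poly (Gpoly a b n) x * x ^ i)) = 0"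
proof -
  define c where "c m = ((real n + a) gchoose m) * ((real n + b) gchoose (n - m))" for m
  define C where "C = Gamma (real n + a + 1) * Gamma (real n + b + 1) * rGamma (a + b + n + i + 2) * (-1) ^ n / fact n"
  have "rho a b x * (poly (Gpoly a b n) x * x ^ i)
      = (\<Sum>m\<le>n. (c m * (-1) ^ (n - m)) * (rho a b x * ((1 - x) ^ (n - m) * x ^ (m + i))))" for x
  proof -
    have "(x - 1) ^ k = (-1) ^ k * (1 - x) ^ k" for k
      by (simp flip: power_mult_distrib)
    then show ?thesis
      by (simp add: Gpoly_def poly_sum c_def[symmetric] sum_distrib_left sum_distrib_right power_add mult_ac)
  qed
  moreover have "set_integrable lborel {0<..<1} (\<lambda>x. rho a b x * ((1 - x) ^ (n - m) * x ^ (m + i)))" for m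
    using rho_poly_integrable[OF ab, of "[:1, -1:] ^ (n - m) * [:0, 1:] ^ (m + i)"] by simp
  ultimately have "(LINT x:{0<..<1}|lborel. rho a b x * (poly (Gpoly a b n) x * x ^ i))
     = (\<Sum>m\<le>n. (c m * (-1) ^ (n - m)) * Beta (b + (m + i) + 1) (a + real (n - m) + 1))"
    by (simp only: set_integral_lincomb rho_monomial_integral[OF ab] of_nat_add)
  also have "\<dots> = (\<Sum>m\<le>n. C * ((-1) ^ m * real (n choose m) * pochhammer (b + 1 + m) i))"
  proof (rule sum.cong[OF refl])
    fix m assume "m \<in> {..n}"
    then have m: "m \<le> n" by simp
    have Gpos: "Gamma z \<noteq> 0" if "0 < z" for z :: real using Gamma_real_pos[OF that] by simp
    have poch: "pochhammer z k = Gamma (z + k) / Gamma z" if "0 < z" for z :: real and k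
      using that by (intro pochhammer_Gamma) (auto elim!: nonpos_Ints_cases)
    have 1: "(real n + a) gchoose m = Gamma (real n + a + 1) / Gamma (a + real (n - m) + 1) / fact m"
    proof -
      have e: "real n + a - real m + 1 = a + real (n - m) + 1" "a + real (n - m) + 1 + real m = real n + a + 1"
        using m by auto
      have "pochhammer (a + real (n - m) + 1) m
          = Gamma (a + real (n - m) + 1 + real m) / Gamma (a + real (n - m) + 1)"
        using ab(1) by (intro poch) linarith
      then show ?thesis unfolding gbinomial_pochhammer' e(1) by (simp only: e(2))
    qed
    have 2: "(real n + b) gchoose (n - m) = Gamma (real n + b + 1) / Gamma (b + 1 + m) / fact (n - m)"
    proof -
      have e: "real n + b - real (n - m) + 1 = b + 1 + real m" "b + 1 + real m + real (n - m) = real n + b + 1"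
        using m by auto
      have "pochhammer (b + 1 + real m) (n - m)
          = Gamma (b + 1 + real m + real (n - m)) / Gamma (b + 1 + real m)"
        using ab(2) by (intro poch) linarith
      then show ?thesis unfolding gbinomial_pochhammer' e(1) by (simp only: e(2))
    qed
    have 3: "pochhammer (b + 1 + m) i = Gamma (b + (m + i) + 1) / Gamma (b + 1 + m)"
      using poch[of "b + 1 + m" i] ab(2) by (simp add: add_ac)
    have 4: "Beta (b + (m + i) + 1) (a + real (n - m) + 1) = Gamma (b + (m + i) + 1) * Gamma (a + real (n - m) + 1) * rGamma (a + b + n + i + 2)"
    proof -
      have "b + (m + i) + 1 + (a + real (n - m) + 1) = a + b + n + i + 2" using m by simp
      then show ?thesis unfolding Beta_altdef by (simp only:)
    qed
    have 5: "real (n choose m) = fact n / (fact m * fact (n - m))"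
      using m by (simp add: binomial_fact)
    have 6: "(-1::real) ^ n * (-1) ^ m = (-1) ^ (n - m)"
    proof -
      have "(-1::real) ^ n = (-1) ^ (n - m) * (-1) ^ m" using m by (simp flip: power_add)
      then show ?thesis by (simp flip: power_mult_distrib)
    qed
    have "Gamma (a + real (n - m) + 1) \<noteq> 0" "Gamma (b + 1 + m) \<noteq> 0" using ab by (auto intro!: Gpos)
    then have "c m * (-1) ^ (n - m) * Beta (b + (m + i) + 1) (a + real (n - m) + 1)
      = Gamma (real n + a + 1) * Gamma (real n + b + 1) * rGamma (a + b + n + i + 2)
         * (-1) ^ (n - m) * (1 / (fact m * fact (n - m))) * pochhammer (b + 1 + m) i"
      unfolding c_def 1 2 3 4 by (simp add: field_simps)
    also have "\<dots> = C * ((-1) ^ m * real (n choose m) * pochhammer (b + 1 + m) i)"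
      unfolding C_def 5 6[symmetric] by (simp add: field_simps)
    finally show "c m * (-1) ^ (n - m) * Beta (b + (m + i) + 1) (a + real (n - m) + 1)
      = C * ((-1) ^ m * real (n choose m) * pochhammer (b + 1 + m) i)" .
  qed
  also have "\<dots> = 0"
    using alternating_pochhammer_sum[OF assms(3), of "b + 1"] by (simp flip: sum_distrib_left)
  finally show ?thesis .
qed

lemma Gpoly_orthogonal:
  fixes a b :: real
  assumes ab: "-1 < a" "-1 < b" and "degree q < n \<or> q = 0"
  shows "(LINT x:{0<..<1}|lborel. rho a b x * poly (Gpoly a b n * q) x) = 0"
proof (cases "q = 0")
  case False
  have I: "set_integrable lborel {0<..<1} (\<lambda>x. rho a b x * (poly (Gpoly a b n) x * x ^ i))" for i
    using rho_poly_integrable[OF ab, of "Gpoly a b n * [:0, 1:] ^ i"] by simp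
  have "(LINT x:{0<..<1}|lborel. rho a b x * poly (Gpoly a b n * q) x)
     = (LINT x:{0<..<1}|lborel. \<Sum>i\<le>degree q. coeff q i * (rho a b x * (poly (Gpoly a b n) x * x ^ i)))"
    by (simp add: poly_altdef[of q] sum_distrib_left mult_ac)
  also have "\<dots> = (\<Sum>i\<le>degree q. coeff q i * (LINT x:{0<..<1}|lborel. rho a b x * (poly (Gpoly a b n) x * x ^ i)))"
    using I by (rule set_integral_lincomb)
  also have "\<dots> = 0"
    using assms False by (intro sum.neutral) (auto intro!: Gpoly_orthogonal_monomial)
  finally show ?thesis .
qed simp

lemma weighted_square_integral_pos:
  fixes a b :: real
  assumes ab: "-1 < a" "-1 < b" and "p \<noteq> 0"
  shows "0 < (LINT x:{0<..<1}|lborel. rho a b x * poly (p * p) x)"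
proof -
  let ?f = "\<lambda>x. indicator {0<..<1} x *\<^sub>R (rho a b x * poly (p * p) x)"
  have I: "integrable lborel ?f"
    using rho_poly_integrable[OF ab, of "p * p"] by (simp only: set_integrable_def)
  have nn: "0 \<le> ?f x" for x by (simp add: rho_def)
  have "integral\<^sup>L lborel ?f \<noteq> 0"
  proof
    assume "integral\<^sup>L lborel ?f = 0"
    then have "AE x in lborel. ?f x = 0"
      using integral_nonneg_eq_0_iff_AE[OF I] nn by simp
    moreover have "AE x in lborel. x \<notin> {x. poly p x = 0}"
      by (rule AE_not_in) (rule finite_imp_null_set_lborel, rule poly_roots_finite[OF assms(3)])
    ultimately have "AE x in lborel. x \<notin> {0<..<1::real}"
      by eventually_elim (auto simp: rho_def)
    then have "{0<..<1::real} \<in> null_sets lborel"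
      by (subst (asm) AE_iff_null_sets[symmetric]) auto
    then show False by (simp add: null_sets_def)
  qed
  moreover have "0 \<le> integral\<^sup>L lborel ?f" using nn by (intro integral_nonneg_AE AE_I2)
  ultimately show ?thesis unfolding set_lebesgue_integral_def by linarith
qed

section \<open>The Jacobi polynomials as eigenfunctions\<close>

context riesz_kernel
begin

text \<open>Integration by parts moves the outer derivative off the potential, \<open>potential_adjoint\<close> transposes the
  kernel, and a second integration by parts restores the derivative on the other side.\<close>

lemma frac_op_adjoint:
  assumes Q: "Q = smult (- 1 / Gamma (2 - (a + b))) (pderiv R)"
    "\<And>x. 0 < x \<Longrightarrow> x < 1 \<Longrightarrow> potential (weighted_deriv a b p) x = poly R x"
    and Q': "Q' = smult (- 1 / Gamma (2 - (a + b))) (pderiv R')"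
    "\<And>x. 0 < x \<Longrightarrow> x < 1 \<Longrightarrow> riesz_kernel.potential b a (1 - r) (weighted_deriv b a q) x = poly R' x"
  shows "(LINT x:{0<..<1}|lborel. rho b a x * poly (Q * q) x)
       = (LINT x:{0<..<1}|lborel. rho a b x * poly (Q' * p) x)"
proof -
  interpret swapped: riesz_kernel b a "1 - r" by (rule swap)
  let ?c = "- 1 / Gamma (2 - (a + b))"
  have "(LINT x:{0<..<1}|lborel. rho b a x * poly (Q * q) x)
    = ?c * (LINT x:{0<..<1}|lborel. rho b a x * poly (pderiv R * q) x)"
    unfolding Q(1) by (simp only: mult_smult_left poly_smult mult.left_commute[of _ ?c] set_integral_mult_right)
  also have "\<dots> = ?c * - (LINT x:{0<..<1}|lborel. rho (b - 1) (a - 1) x * poly (weighted_deriv b a q) x * potential (weighted_deriv a b p) x)"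
  proof -
    have "(LINT x:{0<..<1}|lborel. rho (b - 1) (a - 1) x * poly (R * weighted_deriv b a q) x)
      = (LINT x:{0<..<1}|lborel. rho (b - 1) (a - 1) x * poly (weighted_deriv b a q) x * potential (weighted_deriv a b p) x)"
      by (rule set_lebesgue_integral_cong) (use Q(2) in \<open>auto simp: mult_ac\<close>)
    then show ?thesis by (simp only: weighted_integration_by_parts[OF b(1) a(1)])
  qed
  also have "\<dots> = ?c * - (LINT x:{0<..<1}|lborel. rho (a - 1) (b - 1) x * poly (weighted_deriv a b p) x * swapped.potential (weighted_deriv b a q) x)"
    by (simp only: potential_adjoint)
  also have "\<dots> = ?c * (LINT x:{0<..<1}|lborel. rho a b x * poly (pderiv R' * p) x)"
  proof -
    have "(LINT x:{0<..<1}|lborel. rho (a - 1) (b - 1) x * poly (R' * weighted_deriv a b p) x)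
      = (LINT x:{0<..<1}|lborel. rho (a - 1) (b - 1) x * poly (weighted_deriv a b p) x * swapped.potential (weighted_deriv b a q) x)"
      by (rule set_lebesgue_integral_cong) (use Q'(2) in \<open>auto simp: mult_ac\<close>)
    then show ?thesis by (simp only: weighted_integration_by_parts[OF a(1) b(1)])
  qed
  also have "\<dots> = (LINT x:{0<..<1}|lborel. rho a b x * poly (Q' * p) x)"
    unfolding Q'(1) by (simp only: mult_smult_left poly_smult mult.left_commute[of _ ?c] set_integral_mult_right)
  finally show ?thesis .
qed

text \<open>A triangular operator whose adjoint is also triangular maps orthogonal polynomials to
  orthogonal polynomials: the image of the \<open>n\<close>-th one has degree at most \<open>n\<close> and, by adjointness, is
  orthogonal to all polynomials of lower degree for the exchanged weight. Leading coefficients fix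
  the factor, because those of \<open>G a b n\<close> and \<open>G b a n\<close> agree.\<close>

theorem frac_op_jacobi:
  assumes "0 < x" "x < 1"
  shows "frac_op r (a + b) (\<lambda>x. rho a b x * G a b n x) x = eigval n * G b a n x"
proof -
  interpret swapped: riesz_kernel b a "1 - r" by (rule swap)
  let ?p = "Gpoly a b n"
  have ab: "-1 < a" "-1 < b" using a b by auto
  obtain Q R where
    Q: "\<And>x. 0 < x \<Longrightarrow> x < 1 \<Longrightarrow> frac_op r (a + b) (\<lambda>x. rho a b x * poly ?p x) x = poly Q x"
    "degree Q \<le> n" "coeff Q n = eigval n * coeff ?p n"
    "Q = smult (- 1 / Gamma (2 - (a + b))) (pderiv R)"
    "\<And>x. 0 < x \<Longrightarrow> x < 1 \<Longrightarrow> potential (weighted_deriv a b ?p) x = poly R x"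
    by (rule frac_op_poly[of ?p, unfolded degree_Gpoly[OF ab]]) (rule that)
  (* By the leading coefficients, D vanishes or has degree below n; it will turn out orthogonal to itself. *)
  define D where "D = Q - smult (eigval n) (Gpoly b a n)"
  have D: "degree D < n \<or> D = 0"
  proof -
    have "degree D \<le> n"
      unfolding D_def using Q(2) degree_Gpoly_le[of b a n]
      by (intro degree_diff_le order_trans[OF degree_smult_le]) auto
    moreover have "coeff D n = 0" using Q(3) coeff_Gpoly_swap[of a b n] by (simp add: D_def)
    ultimately show ?thesis by (metis le_neq_implies_less leading_coeff_0_iff)
  qed
  obtain Q' R' where
    Q': "\<And>x. 0 < x \<Longrightarrow> x < 1 \<Longrightarrow> frac_op (1 - r) (b + a) (\<lambda>x. rho b a x * poly D x) x = poly Q' x"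
    "degree Q' \<le> degree D" "coeff Q' (degree D) = swapped.eigval (degree D) * lead_coeff D"
    "Q' = smult (- 1 / Gamma (2 - (b + a))) (pderiv R')"
    "\<And>x. 0 < x \<Longrightarrow> x < 1 \<Longrightarrow> swapped.potential (weighted_deriv b a D) x = poly R' x"
    by (rule swapped.frac_op_poly[of D]) (rule that)
  have "D = 0"
  proof (rule ccontr)
    assume "D \<noteq> 0"
    have D': "degree Q' < n \<or> Q' = 0" using D Q'(2) \<open>D \<noteq> 0\<close> by auto
    have "(LINT x:{0<..<1}|lborel. rho b a x * poly (Q * D) x)
       = (LINT x:{0<..<1}|lborel. rho a b x * poly (Q' * ?p) x)"
      by (rule frac_op_adjoint[OF Q(4,5)]) (use Q'(4,5) in \<open>auto simp: add.commute\<close>)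
    also have "\<dots> = 0"
      using Gpoly_orthogonal[OF ab D'] by (simp add: mult.commute)
    finally have 1: "(LINT x:{0<..<1}|lborel. rho b a x * poly (Q * D) x) = 0" .
    have 2: "(LINT x:{0<..<1}|lborel. rho b a x * poly (Gpoly b a n * D) x) = 0"
      by (rule Gpoly_orthogonal[OF ab(2,1) D])
    have "(Q - smult (eigval n) (Gpoly b a n)) * D = Q * D - smult (eigval n) (Gpoly b a n * D)"
      by (simp add: left_diff_distrib)
    then have "D * D = Q * D - smult (eigval n) (Gpoly b a n * D)"
      by (simp only: D_def[symmetric])
    then have "(LINT x:{0<..<1}|lborel. rho b a x * poly (D * D) x)
      = (LINT x:{0<..<1}|lborel. rho b a x * poly (Q * D) x - eigval n * (rho b a x * poly (Gpoly b a n * D) x))"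
      by (simp only: poly_diff poly_smult right_diff_distrib mult.left_commute[of _ "eigval n"])
    also have "\<dots> = 0"
      using 1 2 rho_poly_integrable[OF ab(2,1)]
      by (simp only: set_integral_diff set_integrable_mult_right set_integral_mult_right)
    finally show False using weighted_square_integral_pos[OF ab(2,1) \<open>D \<noteq> 0\<close>] by simp
  qed
  then have "Q = smult (eigval n) (Gpoly b a n)" by (simp add: D_def)
  then show ?thesis using Q(1)[OF assms] by (simp add: poly_Gpoly)
qed

end

section \<open>The Riesz-Fischer theorem\<close>

lemma abs_mult_le_squares: "\<bar>x * y\<bar> \<le> x\<^sup>2 + (y :: real)\<^sup>2"
proof -
  have "2 * (\<bar>x\<bar> * \<bar>y\<bar>) \<le> x\<^sup>2 + y\<^sup>2"
    using sum_squares_bound[of "\<bar>x\<bar>" "\<bar>y\<bar>"] by (simp add: mult.assoc)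
  moreover have "0 \<le> \<bar>x\<bar> * \<bar>y\<bar>" by simp
  ultimately show ?thesis unfolding abs_mult by linarith
qed

lemma integrable_mult_of_squares:
  fixes f g :: "'a \<Rightarrow> real"
  assumes [measurable]: "f \<in> borel_measurable M" "g \<in> borel_measurable M"
    and "integrable M (\<lambda>x. (f x)\<^sup>2)" "integrable M (\<lambda>x. (g x)\<^sup>2)"
  shows "integrable M (\<lambda>x. f x * g x)"
proof (rule Bochner_Integration.integrable_bound)
  show "integrable M (\<lambda>x. (f x)\<^sup>2 + (g x)\<^sup>2)" using assms by simp
  show "AE x in M. norm (f x * g x) \<le> norm ((f x)\<^sup>2 + (g x)\<^sup>2)"
    using abs_mult_le_squares by simp
qed measurable

lemma orthonormal_sum_inner:
  fixes e :: "nat \<Rightarrow> 'a \<Rightarrow> real"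
  assumes meas: "\<And>j. e j \<in> borel_measurable M"
    and sq: "\<And>j. integrable M (\<lambda>x. (e j x)\<^sup>2)"
    and orth: "\<And>i j. (\<integral>x. e i x * e j x \<partial>M) = (if i = j then 1 else 0)"
    and "finite I"
  shows "(\<integral>x. (\<Sum>i\<in>I. d i * e i x) * e j x \<partial>M) = (if j \<in> I then d j else 0)"
    and "(\<integral>x. (\<Sum>i\<in>I. d i * e i x)\<^sup>2 \<partial>M) = (\<Sum>i\<in>I. (d i)\<^sup>2)"
    and "integrable M (\<lambda>x. (\<Sum>i\<in>I. d i * e i x)\<^sup>2)"
proof -
  have ie: "integrable M (\<lambda>x. e i x * e j x)" for i j
    by (rule integrable_mult_of_squares) (use meas sq in auto)
  show inner: "(\<integral>x. (\<Sum>i\<in>I. d i * e i x) * e j x \<partial>M) = (if j \<in> I then d j else 0)" for j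
    using ie \<open>finite I\<close> by (simp add: sum_distrib_right mult.assoc orth if_distrib cong: if_cong)
  have i1: "integrable M (\<lambda>x. (\<Sum>i\<in>I. d i * e i x) * e j x)" for j
    using ie by (simp add: sum_distrib_right mult.assoc)
  have eq: "(\<Sum>i\<in>I. d i * e i x)\<^sup>2 = (\<Sum>j\<in>I. d j * ((\<Sum>i\<in>I. d i * e i x) * e j x))" for x
  proof -
    have "s * (\<Sum>j\<in>I. d j * e j x) = (\<Sum>j\<in>I. d j * (s * e j x))" for s
      by (simp add: sum_distrib_left mult_ac)
    then show ?thesis unfolding power2_eq_square .
  qed
  show "integrable M (\<lambda>x. (\<Sum>i\<in>I. d i * e i x)\<^sup>2)"
    unfolding eq using i1 by simp
  show "(\<integral>x. (\<Sum>i\<in>I. d i * e i x)\<^sup>2 \<partial>M) = (\<Sum>i\<in>I. (d i)\<^sup>2)"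
    unfolding eq using i1 by (simp add: inner power2_eq_square)
qed

text \<open>Supplies the block boundaries for the proof of the Riesz-Fischer theorem.\<close>

lemma lacunary_subsequence:
  fixes f :: "nat \<Rightarrow> real"
  assumes "summable f" "\<And>j. 0 \<le> f j" "0 < q"
  obtains N C where "N 0 = 0" "mono N" "\<And>k. k \<le> N k" "0 < (C::real)"
    "\<And>k. sum f {N k..<N (Suc k)} \<le> C * q ^ k"
proof -
  have "\<exists>n. \<forall>m\<ge>n. \<forall>m'. norm (sum f {m..<m'}) < q ^ k" for k
    using assms(1,3) by (simp add: summable_Cauchy)
  then obtain n where n: "\<And>k m m'. n k \<le> m \<Longrightarrow> norm (sum f {m..<m'}) < q ^ k" by metis
  (* The summand k forces N to infinity. Block 0 has to start at index 0, where the tail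
     estimate is not available; the factor 1 + suminf f absorbs it. *)
  define N where "N k = (if k = 0 then 0 else (\<Sum>i\<le>k. n i) + k)" for k
  show ?thesis
  proof (rule that[of N "1 + suminf f"])
    show "mono N" by (rule incseq_SucI) (auto simp: N_def incseq_Suc_iff)
    show "k \<le> N k" for k by (simp add: N_def)
    have pos: "0 \<le> suminf f" using assms by (intro suminf_nonneg)
    then show "0 < 1 + suminf f" by simp
    show "sum f {N k..<N (Suc k)} \<le> (1 + suminf f) * q ^ k" for k
    proof (cases "k = 0")
      case True
      have "sum f {N k..<N (Suc k)} \<le> suminf f"
        using assms by (intro sum_le_suminf) auto
      then show ?thesis using True by simp
    next
      case False
      have "n k \<le> N k" using False member_le_sum[of k "{..k}" n] by (simp add: N_def)
      then have "sum f {N k..<N (Suc k)} \<le> q ^ k" using n[of k "N k" "N (Suc k)"] by simp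
      also have "\<dots> \<le> (1 + suminf f) * q ^ k" using pos assms by simp
      finally show ?thesis .
    qed
  qed (simp add: N_def)
qed

text \<open>Grouped into blocks of rapidly decreasing norm, the orthogonal series converges almost
  everywhere, and a weighted Cauchy-Schwarz inequality bounds all partial sums by one square integrable
  function, so that the coefficients of the limit follow by dominated convergence.\<close>

theorem riesz_fischer:
  fixes e :: "nat \<Rightarrow> 'a \<Rightarrow> real"
  assumes meas [measurable]: "\<And>j. e j \<in> borel_measurable M"
    and sq: "\<And>j. integrable M (\<lambda>x. (e j x)\<^sup>2)"
    and orth: "\<And>i j. (\<integral>x. e i x * e j x \<partial>M) = (if i = j then 1 else 0)"
    and d: "summable (\<lambda>j. (d j)\<^sup>2)"
  obtains \<phi> where "\<phi> \<in> borel_measurable M" "integrable M (\<lambda>x. (\<phi> x)\<^sup>2)"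
    "\<And>j. (\<integral>x. \<phi> x * e j x \<partial>M) = d j"
proof -
  (* Blocks of squared norm O(16^-k) leave room for the weights 4^k below, and the weights
     in turn make the Cauchy-Schwarz factor sum 4^-k finite. *)
  obtain N C where N: "N 0 = 0" "mono N" "\<And>k. k \<le> N k" and C: "0 < (C::real)"
    "\<And>k. (\<Sum>j=N k..<N (Suc k). (d j)\<^sup>2) \<le> C * (1/16) ^ k"
    by (rule lacunary_subsequence[OF d, of "1/16"]) auto
  define \<delta> where "\<delta> k x = (\<Sum>j=N k..<N (Suc k). d j * e j x)" for k x
  define S where "S K x = (\<Sum>k<K. \<delta> k x)" for K x
  have [measurable]: "\<delta> k \<in> borel_measurable M" "S k \<in> borel_measurable M" for k
    unfolding S_def[abs_def] \<delta>_def[abs_def] by measurable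
  have S_eq: "S K x = (\<Sum>j<N K. d j * e j x)" for K x
  proof (induction K)
    case (Suc K)
    have "N K \<le> N (Suc K)" using N(2) by (simp add: incseq_SucD)
    then show ?case using Suc
      by (simp add: S_def \<delta>_def lessThan_atLeast0 sum.atLeastLessThan_concat)
  qed (simp add: S_def N)
  let ?w = "\<lambda>k x. 4 ^ k * (\<delta> k x)\<^sup>2"
  have int_w: "integrable M (?w k)" for k
    unfolding \<delta>_def by (intro integrable_mult_right orthonormal_sum_inner(3)[OF meas sq orth]) simp
  have le_w: "(\<integral>x. ?w k x \<partial>M) \<le> C * (1/4) ^ k" for k
  proof -
    have "(\<integral>x. ?w k x \<partial>M) = 4 ^ k * (\<Sum>j=N k..<N (Suc k). (d j)\<^sup>2)"
      unfolding \<delta>_def by (simp add: orthonormal_sum_inner(2)[OF meas sq orth])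
    also have "\<dots> \<le> 4 ^ k * (C * (1/16) ^ k)" by (intro mult_left_mono C) simp
    also have "\<dots> = C * (1/4) ^ k" by (simp add: power_divide power_mult_distrib[symmetric] field_simps)
    finally show ?thesis .
  qed
  have geo: "summable (\<lambda>k. C * (1/4) ^ k)" by (intro summable_mult summable_geometric) simp
  have sum_int: "summable (\<lambda>k. \<integral>x. ?w k x \<partial>M)"
    by (rule summable_comparison_test'[OF geo, of 0]) (use le_w in \<open>simp add: integral_nonneg_AE\<close>)
  have AE_w: "AE x in M. summable (\<lambda>k. ?w k x)"
  proof -
    have "(\<integral>\<^sup>+x. (\<Sum>k. ennreal (?w k x)) \<partial>M) = (\<Sum>k. \<integral>\<^sup>+x. ennreal (?w k x) \<partial>M)"
      by (rule nn_integral_suminf) measurable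
    also have "\<dots> = (\<Sum>k. ennreal (\<integral>x. ?w k x \<partial>M))"
      using int_w by (intro suminf_cong nn_integral_eq_integral) auto
    also have "\<dots> = ennreal (\<Sum>k. \<integral>x. ?w k x \<partial>M)"
      using sum_int by (intro suminf_ennreal2) (simp_all add: integral_nonneg_AE)
    finally have "(\<integral>\<^sup>+x. (\<Sum>k. ennreal (?w k x)) \<partial>M) \<noteq> \<infinity>" by simp
    then have "AE x in M. (\<Sum>k. ennreal (?w k x)) \<noteq> \<infinity>"
      by (intro nn_integral_PInf_AE) measurable
    then show ?thesis
      by eventually_elim (rule summable_suminf_not_top, auto)
  qed
  define g where "g x = (\<Sum>k. ?w k x)" for x
  have int_g: "integrable M g"
    unfolding g_def by (rule integrable_suminf) (use int_w AE_w sum_int in auto)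
  define \<phi> where "\<phi> x = (\<Sum>k. \<delta> k x)" for x
  have meas_\<phi> [measurable]: "\<phi> \<in> borel_measurable M" unfolding \<phi>_def[abs_def] by measurable
  have bound_S: "(S K x)\<^sup>2 \<le> 2 * g x" if "summable (\<lambda>k. ?w k x)" for K x
  proof -
    have "(S K x)\<^sup>2 = (\<Sum>k<K. (1/2) ^ k * (2 ^ k * \<delta> k x))\<^sup>2"
      by (simp add: S_def power_one_over)
    also have "\<dots> \<le> (\<Sum>k<K. ((1/2) ^ k)\<^sup>2) * (\<Sum>k<K. (2 ^ k * \<delta> k x)\<^sup>2)"
      by (rule Cauchy_Schwarz_ineq_sum)
    also have "\<dots> \<le> 2 * g x"
    proof (rule mult_mono)
      have "(\<Sum>k<K. ((1/2::real) ^ k)\<^sup>2) = (\<Sum>k<K. (1/4) ^ k)"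
        by (rule sum.cong) (simp_all add: power2_eq_square power_mult_distrib[symmetric])
      also have "\<dots> \<le> (\<Sum>k. (1/4) ^ k)"
        by (rule sum_le_suminf) (auto intro: summable_geometric)
      also have "\<dots> \<le> 2" by (subst suminf_geometric) simp_all
      finally show "(\<Sum>k<K. ((1/2::real) ^ k)\<^sup>2) \<le> 2" .
      have "(\<Sum>k<K. (2 ^ k * \<delta> k x)\<^sup>2) = (\<Sum>k<K. ?w k x)"
        by (rule sum.cong) (simp_all add: power2_eq_square power_mult_distrib[symmetric] mult_ac)
      also have "\<dots> \<le> g x" unfolding g_def using that by (intro sum_le_suminf) auto
      finally show "(\<Sum>k<K. (2 ^ k * \<delta> k x)\<^sup>2) \<le> g x" .
    qed (auto intro: sum_nonneg)
    finally show ?thesis .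
  qed
  have S_lim: "(\<lambda>K. S K x) \<longlonglongrightarrow> \<phi> x" if "summable (\<lambda>k. ?w k x)" for x
  proof -
    have "summable (\<lambda>k. (1/4) ^ k + ?w k x)"
      using that by (intro summable_add summable_geometric) auto
    then have "summable (\<lambda>k. \<delta> k x)"
    proof (rule summable_comparison_test'[of _ 0])
      fix k
      have "\<bar>(1/2) ^ k * (2 ^ k * \<delta> k x)\<bar> \<le> ((1/2) ^ k)\<^sup>2 + (2 ^ k * \<delta> k x)\<^sup>2"
        by (rule abs_mult_le_squares)
      moreover have "(1/2) ^ k * (2 ^ k * \<delta> k x) = \<delta> k x" by (simp add: power_one_over)
      moreover have "((1/2::real) ^ k)\<^sup>2 = (1/4) ^ k" "(2 ^ k * \<delta> k x)\<^sup>2 = ?w k x"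
        by (simp_all add: power2_eq_square power_mult_distrib[symmetric] mult_ac)
      ultimately show "norm (\<delta> k x) \<le> (1/4) ^ k + ?w k x" by simp
    qed
    then show ?thesis unfolding S_def \<phi>_def by (rule summable_LIMSEQ)
  qed
  have bound_\<phi>: "(\<phi> x)\<^sup>2 \<le> 2 * g x" if "summable (\<lambda>k. ?w k x)" for x
    using tendsto_power[OF S_lim[OF that], of 2] bound_S[OF that] by (intro LIMSEQ_le_const2) auto
  have g_nonneg: "0 \<le> g x" if "summable (\<lambda>k. ?w k x)" for x
    unfolding g_def using that by (intro suminf_nonneg) auto
  have int_\<phi>: "integrable M (\<lambda>x. (\<phi> x)\<^sup>2)"
  proof (rule Bochner_Integration.integrable_bound)
    show "integrable M (\<lambda>x. 2 * g x)" using int_g by simp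
    show "AE x in M. norm ((\<phi> x)\<^sup>2) \<le> norm (2 * g x)"
      using AE_w by eventually_elim (use bound_\<phi> g_nonneg in auto)
  qed measurable
  have "(\<integral>x. \<phi> x * e j x \<partial>M) = d j" for j
  proof -
    have "(\<lambda>K. \<integral>x. S K x * e j x \<partial>M) \<longlonglongrightarrow> (\<integral>x. \<phi> x * e j x \<partial>M)"
    proof (rule integral_dominated_convergence[where w = "\<lambda>x. 2 * g x + (e j x)\<^sup>2"])
      show "integrable M (\<lambda>x. 2 * g x + (e j x)\<^sup>2)" using int_g sq by simp
      show "AE x in M. (\<lambda>K. S K x * e j x) \<longlonglongrightarrow> \<phi> x * e j x"
        using AE_w by eventually_elim (intro tendsto_mult S_lim tendsto_const)
      show "AE x in M. norm (S K x * e j x) \<le> 2 * g x + (e j x)\<^sup>2" for K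
        using AE_w
      proof eventually_elim
        case (elim x)
        have "\<bar>S K x * e j x\<bar> \<le> (S K x)\<^sup>2 + (e j x)\<^sup>2"
          by (rule abs_mult_le_squares)
        then show ?case using bound_S[OF elim, of K] by simp
      qed
    qed measurable
    moreover have "eventually (\<lambda>K. (\<integral>x. S K x * e j x \<partial>M) = d j) sequentially"
    proof (rule eventually_sequentiallyI[of "Suc j"])
      fix K assume "Suc j \<le> K"
      then have "j < N K" using N(3)[of K] by linarith
      then show "(\<integral>x. S K x * e j x \<partial>M) = d j"
        unfolding S_eq by (simp add: orthonormal_sum_inner(1)[OF meas sq orth])
    qed
    ultimately have "(\<lambda>K. d j) \<longlonglongrightarrow> (\<integral>x. \<phi> x * e j x \<partial>M)"
      by (rule Lim_transform_eventually)
    then show ?thesis by (simp add: LIMSEQ_const_iff)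
  qed
  then show ?thesis using that meas_\<phi> int_\<phi> by blast
qed

section \<open>Vanishing moments\<close>

text \<open>Weierstrass approximation on the unit interval.\<close>

lemma orthogonal_to_continuous:
  fixes H f :: "real \<Rightarrow> real"
  assumes I: "integrable lebesgue H" and supp: "\<And>x. x \<notin> {0..1} \<Longrightarrow> H x = 0"
    and moments: "\<And>p. (\<integral>x. H x * poly p x \<partial>lebesgue) = 0"
    and f: "continuous_on UNIV f"
  shows "integrable lebesgue (\<lambda>x. H x * f x)" "(\<integral>x. H x * f x \<partial>lebesgue) = 0"
proof -
  have int: "integrable lebesgue (\<lambda>x. H x * f x)" if f: "continuous_on UNIV f" for f :: "real \<Rightarrow> real"
  proof -
    have "bounded (f ` {0..1})"
      by (intro compact_imp_bounded compact_continuous_image continuous_on_subset[OF f]) auto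
    then have "\<exists>M. \<forall>x\<in>{0..1}. \<bar>f x\<bar> \<le> M" by (auto simp: bounded_iff)
    then obtain M where M: "\<And>x. x \<in> {0..1} \<Longrightarrow> \<bar>f x\<bar> \<le> M" by blast
    have [measurable]: "f \<in> borel_measurable lebesgue"
      using borel_measurable_continuous_onI[OF f] by (intro measurable_completion) simp
    have [measurable]: "H \<in> borel_measurable lebesgue" using I by auto
    show ?thesis
    proof (rule Bochner_Integration.integrable_bound)
      show "integrable lebesgue (\<lambda>x. M * H x)" using I by simp
      have "norm (H x * f x) \<le> norm (M * H x)" for x
      proof (cases "x \<in> {0..1}")
        case True
        then have "\<bar>f x\<bar> * \<bar>H x\<bar> \<le> \<bar>M\<bar> * \<bar>H x\<bar>" using M[of x] by (intro mult_right_mono) auto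
        then show ?thesis by (simp add: abs_mult mult.commute)
      qed (simp add: supp)
      then show "AE x in lebesgue. norm (H x * f x) \<le> norm (M * H x)" by simp
    qed measurable
  qed
  show If: "integrable lebesgue (\<lambda>x. H x * f x)" by (rule int[OF f])
  have "\<bar>\<integral>x. H x * f x \<partial>lebesgue\<bar> \<le> \<epsilon> * (\<integral>x. \<bar>H x\<bar> \<partial>lebesgue)" if "0 < \<epsilon>" for \<epsilon>
  proof -
    obtain g where g: "real_polynomial_function g" "\<And>x. x \<in> {0..1} \<Longrightarrow> \<bar>f x - g x\<bar> < \<epsilon>"
      using Stone_Weierstrass_real_polynomial_function[of "{0..1::real}" f \<epsilon>] f \<open>0 < \<epsilon>\<close>
        continuous_on_subset[OF f] by auto
    then obtain c n where c: "g = (\<lambda>x. \<Sum>i\<le>n. c i * x ^ i)"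
      by (auto simp: real_polynomial_function_iff_sum)
    define p where "p = (\<Sum>i\<le>n. monom (c i) i)"
    have p: "poly p x = g x" for x by (simp add: p_def c poly_sum poly_monom)
    have Ip: "integrable lebesgue (\<lambda>x. H x * poly p x)" by (intro int continuous_intros)
    have "(\<integral>x. H x * f x \<partial>lebesgue) = (\<integral>x. H x * f x - H x * poly p x \<partial>lebesgue)"
      using If Ip moments[of p] by simp
    also have "\<bar>\<dots>\<bar> \<le> (\<integral>x. \<epsilon> * \<bar>H x\<bar> \<partial>lebesgue)"
    proof (rule integral_abs_bound_integral)
      show "integrable lebesgue (\<lambda>x. H x * f x - H x * poly p x)" using If Ip by simp
      show "integrable lebesgue (\<lambda>x. \<epsilon> * \<bar>H x\<bar>)" using I by simp
      show "\<bar>H x * f x - H x * poly p x\<bar> \<le> \<epsilon> * \<bar>H x\<bar>" for x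
      proof (cases "x \<in> {0..1}")
        case True
        have "\<bar>H x * f x - H x * poly p x\<bar> = \<bar>f x - g x\<bar> * \<bar>H x\<bar>"
          by (simp add: p abs_mult[symmetric] algebra_simps)
        then show ?thesis using g(2)[OF True] by (simp add: mult_right_mono)
      qed (simp add: supp)
    qed
    finally show ?thesis by simp
  qed
  note small = this
  show "(\<integral>x. H x * f x \<partial>lebesgue) = 0"
  proof (rule ccontr)
    let ?A = "\<integral>x. H x * f x \<partial>lebesgue" and ?B = "\<integral>x. \<bar>H x\<bar> \<partial>lebesgue"
    assume "?A \<noteq> 0"
    have B: "0 \<le> ?B" by simp
    (* This epsilon makes the bound strictly smaller than |?A|, also when ?B = 0. *)
    have "\<bar>?A\<bar> \<le> (\<bar>?A\<bar> / (2 * (?B + 1))) * ?B"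
      using \<open>?A \<noteq> 0\<close> B by (intro small divide_pos_pos mult_pos_pos add_nonneg_pos) auto
    also have "\<dots> < \<bar>?A\<bar>"
    proof -
      have "u / (2 * (t + 1)) * t < u" if "0 < u" "0 \<le> t" for u t :: real
      proof -
        have "u * t < u * (2 * (t + 1))" using that by (intro mult_strict_left_mono) auto
        then show ?thesis using that by (simp add: pos_divide_less_eq)
      qed
      then show ?thesis using \<open>?A \<noteq> 0\<close> B by simp
    qed
    finally show False by simp
  qed
qed

text \<open>Approximating \<open>sgn H\<close> almost everywhere by continuous functions shows that the integral of
  \<open>\<bar>H\<bar>\<close> vanishes.\<close>

lemma zero_moments_imp_AE_zero:
  fixes H :: "real \<Rightarrow> real"
  assumes I: "integrable lebesgue H" and supp: "\<And>x. x \<notin> {0..1} \<Longrightarrow> H x = 0"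
    and moments: "\<And>p. (\<integral>x. H x * poly p x \<partial>lebesgue) = 0"
  shows "AE x in lebesgue. H x = 0"
proof -
  have [measurable]: "H \<in> borel_measurable lebesgue" using I by auto
  have "(\<lambda>x. sgn (H x)) \<in> borel_measurable lebesgue" by measurable
  then have "(\<lambda>x. sgn (H x)) measurable_on UNIV"
    by (rule lebesgue_measurable_imp_measurable_on) simp
  then obtain Z g where Z: "negligible Z" and cont: "\<And>n. continuous_on UNIV (g n)"
    and lim: "\<And>x. x \<notin> Z \<Longrightarrow> (\<lambda>n. g n x) \<longlonglongrightarrow> sgn (H x)"
    unfolding measurable_on_def by auto
  (* Truncation keeps the functions continuous and the limit sgn H unchanged, and makes
     |H| a dominating function. *)
  define c where "c n x = max (-1) (min 1 (g n x))" for n x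
  have cont_c: "continuous_on UNIV (c n)" for n
    unfolding c_def[abs_def] by (intro continuous_intros cont)
  have meas_c [measurable]: "c n \<in> borel_measurable lebesgue" for n
    using borel_measurable_continuous_onI[OF cont_c] by (intro measurable_completion) simp
  have "(\<lambda>n. \<integral>x. H x * c n x \<partial>lebesgue) \<longlonglongrightarrow> (\<integral>x. H x * sgn (H x) \<partial>lebesgue)"
  proof (rule integral_dominated_convergence[where w = "\<lambda>x. \<bar>H x\<bar>"])
    have "AE x in lebesgue. x \<notin> Z" using Z by (intro AE_not_in) (simp add: negligible_iff_null_sets)
    then show "AE x in lebesgue. (\<lambda>n. H x * c n x) \<longlonglongrightarrow> H x * sgn (H x)"
    proof eventually_elim
      case (elim x)
      have "(\<lambda>n. c n x) \<longlonglongrightarrow> max (-1) (min 1 (sgn (H x)))"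
        unfolding c_def by (intro tendsto_max tendsto_min tendsto_const lim elim)
      moreover have "max (-1) (min 1 (sgn (H x))) = sgn (H x)" by (simp add: sgn_if)
      ultimately show ?case by (intro tendsto_mult tendsto_const) simp
    qed
    have "\<bar>c n x\<bar> \<le> 1" for n x by (auto simp: c_def)
    then have "\<bar>H x\<bar> * \<bar>c n x\<bar> \<le> \<bar>H x\<bar> * 1" for n x by (intro mult_left_mono) auto
    then show "AE x in lebesgue. norm (H x * c n x) \<le> \<bar>H x\<bar>" for n
      by (simp add: abs_mult)
  qed (use I in auto)
  then have "(\<lambda>n::nat. 0) \<longlonglongrightarrow> (\<integral>x. H x * sgn (H x) \<partial>lebesgue)"
    using orthogonal_to_continuous(2)[OF I supp moments cont_c] by simp
  then have "(\<integral>x. \<bar>H x\<bar> \<partial>lebesgue) = 0"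
    by (simp add: LIMSEQ_const_iff abs_sgn[symmetric])
  then show ?thesis
    using integral_nonneg_eq_0_iff_AE[of lebesgue "\<lambda>x. \<bar>H x\<bar>"] I by simp
qed

section \<open>Linearity of the operator and growth of the eigenvalues\<close>

context riesz_kernel
begin

lemma potential_sum:
  assumes "finite I" "0 < x" "x < 1"
  shows "potential (weighted_deriv a b (\<Sum>i\<in>I. smult (c i) (p i))) x = (\<Sum>i\<in>I. c i * potential (weighted_deriv a b (p i)) x)"
  using assms(1)
proof induction
  case empty
  have "weighted_deriv a b 0 = smult 0 0" by (simp add: weighted_deriv_def)
  then show ?case by (simp only: sum.empty potential_smult)
next
  case (insert i I)
  then show ?case using assms
    by (simp add: weighted_deriv_add weighted_deriv_smult potential_add potential_smult)
qed

text \<open>Linearity is not automatic for \<open>deriv\<close>; it rests on the differentiability of the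
  one-sided integrals.\<close>

lemma frac_op_sum:
  assumes "finite I" "0 < x" "x < 1"
  shows "frac_op r (a + b) (\<lambda>x. rho a b x * (\<Sum>i\<in>I. c i * poly (p i) x)) x
       = (\<Sum>i\<in>I. c i * frac_op r (a + b) (\<lambda>x. rho a b x * poly (p i) x) x)"
proof -
  have "\<exists>D. (potential (weighted_deriv a b q) has_real_derivative D) (at x)" for q
  proof -
    obtain L R where "(left_int (2 - (a + b)) a b (weighted_deriv a b q) has_real_derivative L) (at x)"
      "(right_int (2 - (a + b)) a b (weighted_deriv a b q) has_real_derivative R) (at x)"
      using potential_differentiable[OF assms(2,3)] by blast
    from DERIV_add[OF DERIV_cmult[OF this(1), of r] DERIV_cmult[OF this(2), of "1 - r"]]
    show ?thesis unfolding potential_def[abs_def] by blast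
  qed
  then obtain D where D: "\<And>q. (potential (weighted_deriv a b q) has_real_derivative D q) (at x)" by metis
  have "((\<lambda>x. \<Sum>i\<in>I. c i * potential (weighted_deriv a b (p i)) x) has_real_derivative (\<Sum>i\<in>I. c i * D (p i))) (at x)"
    by (intro DERIV_sum DERIV_cmult D)
  then have "(potential (weighted_deriv a b (\<Sum>i\<in>I. smult (c i) (p i))) has_real_derivative (\<Sum>i\<in>I. c i * D (p i))) (at x)"
    by (rule has_field_derivative_transform_within_open[where S = "{0<..<1}"])
      (use assms in \<open>auto simp: potential_sum\<close>)
  from frac_op_eq_deriv_potential[OF assms(2,3) this] show ?thesis
    by (simp add: poly_sum frac_op_eq_deriv_potential[OF assms(2,3) D] sum_negf sum_divide_distrib)
qed

text \<open>The quotient \<open>pochhammer \<alpha> (n + 1) / n!\<close> is \<open>n powr \<alpha>\<close> divided by the \<open>n\<close>-th term of a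
  sequence converging to \<open>Gamma \<alpha>\<close>, hence the eigenvalues grow at least like \<open>n powr \<alpha>\<close>. This is
  the gain of \<open>\<alpha>\<close> orders of regularity.\<close>

lemma eigval_lower_bound:
  obtains c where "0 < c" "\<And>n. c * (1 + (real n)\<^sup>2) powr ((a + b) / 2) \<le> eigval n"
proof -
  let ?\<alpha> = "a + b" and ?k = "potential 1 (1/2) * (a + b - 1) / Gamma (2 - (a + b))"
  have k: "0 < ?k" using potential_one_pos order by (intro mult_pos_pos divide_pos_pos) (auto simp: Gamma_real_pos)
  have "convergent (\<lambda>n. Gamma_series ?\<alpha> n)"
    using Gamma_series_LIMSEQ[of ?\<alpha>] by (auto simp: convergent_def)
  then obtain B where B: "0 < B" "\<And>n. \<bar>Gamma_series ?\<alpha> n\<bar> \<le> B"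
    by (auto dest!: convergent_imp_Bseq simp: Bseq_def)
  have growth: "(real n) powr ?\<alpha> / B \<le> pochhammer ?\<alpha> (Suc n) / fact n" if "0 < n" for n
  proof -
    have p: "0 < pochhammer ?\<alpha> (Suc n)" using order by (intro pochhammer_pos) simp
    have "Gamma_series ?\<alpha> n = fact n * (real n) powr ?\<alpha> / pochhammer ?\<alpha> (Suc n)"
      using that by (simp add: Gamma_series_def powr_def)
    moreover have "Gamma_series ?\<alpha> n \<le> B" using B(2)[of n] by linarith
    ultimately have "fact n * (real n) powr ?\<alpha> / pochhammer ?\<alpha> (Suc n) \<le> B" by simp
    then have "fact n * (real n) powr ?\<alpha> \<le> B * pochhammer ?\<alpha> (Suc n)"
      using p by (simp only: pos_divide_le_eq)
    then show ?thesis using B(1) by (simp add: divide_simps mult_ac)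
  qed
  define c where "c = min (eigval 0) (?k / (B * 2 powr (?\<alpha> / 2)))"
  have "0 < c"
    unfolding c_def min_less_iff_conj
    using B(1) by (intro conjI eigval_pos divide_pos_pos[OF k] mult_pos_pos) auto
  moreover have "c * (1 + (real n)\<^sup>2) powr (?\<alpha> / 2) \<le> eigval n" for n
  proof (cases "n = 0")
    case False
    have "(1::real) \<le> (real n)\<^sup>2" using False by (simp add: one_le_power)
    then have "(1 + (real n)\<^sup>2) powr (?\<alpha> / 2) \<le> (2 * (real n)\<^sup>2) powr (?\<alpha> / 2)"
      using order by (intro powr_mono2) auto
    also have "\<dots> = 2 powr (?\<alpha> / 2) * (real n) powr ?\<alpha>"
    proof -
      have "(x\<^sup>2) powr (t / 2) = x powr t" if "0 < x" for x t :: real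
        using that by (simp add: powr_powr flip: powr_numeral)
      then have "((real n)\<^sup>2) powr (?\<alpha> / 2) = (real n) powr ?\<alpha>" using False by simp
      then show ?thesis by (simp only: powr_mult)
    qed
    finally have "c * (1 + (real n)\<^sup>2) powr (?\<alpha> / 2) \<le> c * (2 powr (?\<alpha> / 2) * (real n) powr ?\<alpha>)"
      using \<open>0 < c\<close> by (intro mult_left_mono) auto
    also have "\<dots> \<le> ?k / (B * 2 powr (?\<alpha> / 2)) * (2 powr (?\<alpha> / 2) * (real n) powr ?\<alpha>)"
      by (intro mult_right_mono) (auto simp: c_def)
    also have "\<dots> = ?k * ((real n) powr ?\<alpha> / B)" using B(1) by simp
    also have "\<dots> \<le> eigval n"
      unfolding eigval_def using growth[of n] k False by (intro mult_left_mono) auto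
    finally show ?thesis .
  qed (simp add: c_def)
  ultimately show ?thesis using that by blast
qed

end

section \<open>Jacobi expansions of square integrable functions\<close>

lemma unit_integral_lebesgue:
  fixes f :: "real \<Rightarrow> real"
  assumes [measurable]: "f \<in> borel_measurable borel"
  shows "(LINT x:unit_ivl|lebesgue. f x) = (LINT x:unit_ivl|lborel. f x)"
    and "set_integrable lebesgue unit_ivl f \<longleftrightarrow> set_integrable lborel unit_ivl f"
  unfolding set_lebesgue_integral_def set_integrable_def
  by (subst integral_completion integrable_completion; measurable)+

definition G_norm :: "real \<Rightarrow> real \<Rightarrow> nat \<Rightarrow> real" where
  "G_norm a b j = sqrt (LINT y:unit_ivl|lebesgue. rho a b y * (G a b j y)\<^sup>2)"

lemma Gn_eq: "Gn a b j x = G a b j x / G_norm a b j"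
  by (simp add: Gn_def G_norm_def)

lemma G_norm_sq_lborel:
  "(LINT y:unit_ivl|lebesgue. rho a b y * (G a b j y)\<^sup>2)
    = (LINT y:unit_ivl|lborel. rho a b y * poly (Gpoly a b j * Gpoly a b j) y)"
  by (simp add: unit_integral_lebesgue poly_Gpoly[symmetric] power2_eq_square)

lemma G_norm_pos:
  assumes "-1 < a" "-1 < b"
  shows "0 < G_norm a b j"
proof -
  have "Gpoly a b j \<noteq> 0" using coeff_Gpoly_pos[OF assms, of j] by auto
  from weighted_square_integral_pos[OF assms this] show ?thesis
    by (simp only: G_norm_def G_norm_sq_lborel real_sqrt_gt_zero)
qed

text \<open>By reflection. The equality lets the eigenvalue relation pass unchanged to the normalised
  polynomials.\<close>

lemma G_norm_swap: "G_norm a b j = G_norm b a j"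
proof -
  have "indicator {0<..<1} (1 + - 1 * x) *\<^sub>R (rho a b (1 + - 1 * x) * poly (Gpoly a b j * Gpoly a b j) (1 + - 1 * x))
    = indicator {0<..<1} x *\<^sub>R (rho b a x * poly (Gpoly b a j * Gpoly b a j) x)" for x
  proof -
    have "poly (Gpoly a b j * Gpoly a b j) (1 + - 1 * x) = ((-1) ^ j * (-1) ^ j) * (poly (Gpoly b a j * Gpoly b a j) x)"
      using G_reflect[of a b j x] by (simp add: poly_Gpoly)
    also have "(-1::real) ^ j * (-1) ^ j = 1" by (simp flip: power_mult_distrib)
    finally show ?thesis by (auto simp: indicator_def rho_def mult_ac)
  qed
  then show ?thesis
    unfolding G_norm_def G_norm_sq_lborel unfolding set_lebesgue_integral_def
    by (subst lborel_integral_real_affine[where c = "-1" and t = 1]) auto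
qed

lemma Gn_poly: "Gn a b j x = poly (smult (1 / G_norm a b j) (Gpoly a b j)) x"
  by (simp add: Gn_eq poly_Gpoly)

lemma Gn_orthonormal:
  assumes ab: "-1 < a" "-1 < b"
  shows "(LINT x:unit_ivl|lebesgue. rho a b x * Gn a b i x * Gn a b j x) = (if i = j then 1 else 0)"
proof -
  let ?c = "1 / (G_norm a b i * G_norm a b j)"
  have "(LINT x:unit_ivl|lebesgue. rho a b x * Gn a b i x * Gn a b j x)
     = (LINT x:unit_ivl|lebesgue. ?c * (rho a b x * poly (Gpoly a b i * Gpoly a b j) x))"
    by (simp add: Gn_poly mult_ac)
  also have "\<dots> = ?c * (LINT x:unit_ivl|lborel. rho a b x * poly (Gpoly a b i * Gpoly a b j) x)"
  proof -
    have "(\<lambda>x. rho a b x * poly (Gpoly a b i * Gpoly a b j) x) \<in> borel_measurable borel"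
      by measurable
    then show ?thesis by (simp only: unit_integral_lebesgue(1) set_integral_mult_right)
  qed
  also have "\<dots> = (if i = j then 1 else 0)"
  proof (cases "i = j")
    case True
    have "(LINT x:unit_ivl|lborel. rho a b x * poly (Gpoly a b j * Gpoly a b j) x) = (G_norm a b j)\<^sup>2"
    proof -
      have "Gpoly a b j \<noteq> 0" using coeff_Gpoly_pos[OF ab, of j] by auto
      from less_imp_le[OF weighted_square_integral_pos[OF ab this]] show ?thesis
        unfolding G_norm_def G_norm_sq_lborel by (simp only: real_sqrt_pow2)
    qed
    then show ?thesis using G_norm_pos[OF ab, of j] True by (simp add: power2_eq_square)
  next
    case False
    then consider "j < i" | "i < j" by linarith
    then have "(LINT x:unit_ivl|lborel. rho a b x * poly (Gpoly a b i * Gpoly a b j) x) = 0"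
    proof cases
      case 1
      then show ?thesis using Gpoly_orthogonal[OF ab, of "Gpoly a b j" i] degree_Gpoly[OF ab] by simp
    next
      case 2
      then show ?thesis using Gpoly_orthogonal[OF ab, of "Gpoly a b i" j] degree_Gpoly[OF ab]
        by (simp add: mult.commute[of "Gpoly a b i"])
    qed
    then show ?thesis using False by simp
  qed
  finally show ?thesis .
qed

lemma wL2_root_integrable:
  assumes "v \<in> wL2 a b"
  shows "(\<lambda>x. indicator unit_ivl x * (sqrt (rho a b x) * v x)) \<in> borel_measurable lebesgue"
    and "integrable lebesgue (\<lambda>x. (indicator unit_ivl x * (sqrt (rho a b x) * v x))\<^sup>2)"
proof -
  have [measurable]: "(\<lambda>x. indicator unit_ivl x *\<^sub>R v x) \<in> borel_measurable lebesgue"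
    using assms by (simp add: wL2_def set_borel_measurable_def)
  have [measurable]: "(\<lambda>x. sqrt (rho a b x)) \<in> borel_measurable lebesgue"
    by (intro measurable_completion) measurable
  have "(\<lambda>x. sqrt (rho a b x) * (indicator unit_ivl x *\<^sub>R v x)) \<in> borel_measurable lebesgue"
    by measurable
  then show "(\<lambda>x. indicator unit_ivl x * (sqrt (rho a b x) * v x)) \<in> borel_measurable lebesgue"
    by (simp add: mult.left_commute)
  have "0 \<le> rho a b x" for x by (simp add: rho_def)
  then have "(indicator unit_ivl x * (sqrt (rho a b x) * v x))\<^sup>2 = indicator unit_ivl x *\<^sub>R (rho a b x * (v x)\<^sup>2)" for x
    by (simp add: power_mult_distrib indicator_def)
  then show "integrable lebesgue (\<lambda>x. (indicator unit_ivl x * (sqrt (rho a b x) * v x))\<^sup>2)"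
    using assms by (simp add: wL2_def set_integrable_def)
qed

lemma wL2_poly:
  assumes ab: "-1 < a" "-1 < b" and g: "\<And>x. x \<in> unit_ivl \<Longrightarrow> g x = poly p x"
  shows "g \<in> wL2 a b"
proof -
  have eq: "indicator unit_ivl x *\<^sub>R g x = indicator unit_ivl x *\<^sub>R poly p x" for x
    using g[of x] by (simp add: indicator_def)
  have "(\<lambda>x. indicator unit_ivl x *\<^sub>R poly p x) \<in> borel_measurable lebesgue"
    by (intro measurable_completion) measurable
  moreover have "set_integrable lebesgue unit_ivl (\<lambda>x. rho a b x * poly (p * p) x)"
    using rho_poly_integrable[OF ab, of "p * p"] by (subst unit_integral_lebesgue(2)) measurable
  moreover have "indicator unit_ivl x *\<^sub>R (rho a b x * (g x)\<^sup>2) = indicator unit_ivl x *\<^sub>R (rho a b x * poly (p * p) x)" for x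
    using g[of x] by (simp add: indicator_def power2_eq_square)
  ultimately show ?thesis
    unfolding wL2_def set_borel_measurable_def set_integrable_def by (simp only: eq mem_Collect_eq simp_thms)
qed

text \<open>Distributes the weight evenly over two factors, turning weighted square integrability into
  plain square integrability.\<close>

lemma rho_product_root:
  "indicator unit_ivl x *\<^sub>R (rho a b x * v x * w x)
    = (indicator unit_ivl x * (sqrt (rho a b x) * v x)) * (indicator unit_ivl x * (sqrt (rho a b x) * w x))"
proof -
  have "rho a b x = sqrt (rho a b x) * sqrt (rho a b x)" by (simp add: rho_def)
  then have "rho a b x * v x * w x = (sqrt (rho a b x) * v x) * (sqrt (rho a b x) * w x)"
    by (metis mult.assoc mult.commute)
  then show ?thesis by (simp add: indicator_def)
qed

lemma wL2_product_integrable: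
  assumes "v \<in> wL2 a b" "w \<in> wL2 a b"
  shows "set_integrable lebesgue unit_ivl (\<lambda>x. rho a b x * v x * w x)"
  unfolding set_integrable_def rho_product_root
  by (intro integrable_mult_of_squares wL2_root_integrable assms)

lemma jcoef_finite_sum:
  assumes ab: "-1 < a" "-1 < b"
    and g: "\<And>x. x \<in> unit_ivl \<Longrightarrow> g x = (\<Sum>j\<le>N. c j * Gn a b j x)"
  shows "g \<in> wL2 a b" "jcoef a b g i = (if i \<le> N then c i else 0)"
proof -
  have GwL2: "Gn a b j \<in> wL2 a b" for j by (rule wL2_poly[OF ab]) (rule Gn_poly)
  show "g \<in> wL2 a b"
    by (rule wL2_poly[OF ab, of _ "\<Sum>j\<le>N. smult (c j) (smult (1 / G_norm a b j) (Gpoly a b j))"])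
      (simp only: g Gn_poly poly_sum poly_smult)
  have "jcoef a b g i = (LINT x:unit_ivl|lebesgue. \<Sum>j\<le>N. c j * (rho a b x * Gn a b j x * Gn a b i x))"
    unfolding jcoef_def
    by (intro set_lebesgue_integral_cong) (simp_all add: g sum_distrib_left sum_distrib_right mult_ac)
  also have "\<dots> = (\<Sum>j\<le>N. c j * (LINT x:unit_ivl|lebesgue. rho a b x * Gn a b j x * Gn a b i x))"
    by (intro set_integral_lincomb wL2_product_integrable GwL2)
  also have "\<dots> = (if i \<le> N then c i else 0)"
    by (simp add: Gn_orthonormal[OF ab] if_distrib cong: if_cong)
  finally show "jcoef a b g i = (if i \<le> N then c i else 0)" .
qed

lemma wL2_with_coefficients:
  assumes ab: "-1 < a" "-1 < b" and d: "summable (\<lambda>j. (d j)\<^sup>2)"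
  obtains v where "v \<in> wL2 a b" "\<And>j. jcoef a b v j = d j"
proof -
  (* Moving the square root of the weight into the functions reduces the weighted space
     to the unweighted one. *)
  define e where "e j x = indicator unit_ivl x * (sqrt (rho a b x) * Gn a b j x)" for j x
  have GwL2: "Gn a b j \<in> wL2 a b" for j by (rule wL2_poly[OF ab]) (rule Gn_poly)
  have e_meas: "e j \<in> borel_measurable lebesgue" "integrable lebesgue (\<lambda>x. (e j x)\<^sup>2)" for j
    using wL2_root_integrable[OF GwL2[of j]] by (simp_all add: e_def[abs_def])
  have orth: "(\<integral>x. e i x * e j x \<partial>lebesgue) = (if i = j then 1 else 0)" for i j
    using Gn_orthonormal[OF ab, of i j] unfolding set_lebesgue_integral_def rho_product_root e_def .
  obtain \<phi> where \<phi>: "\<phi> \<in> borel_measurable lebesgue" "integrable lebesgue (\<lambda>x. (\<phi> x)\<^sup>2)"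
    "\<And>j. (\<integral>x. \<phi> x * e j x \<partial>lebesgue) = d j"
    by (rule riesz_fischer[OF e_meas orth d]) (rule that)
  define v where "v x = \<phi> x / sqrt (rho a b x)" for x
  have rho_pos: "0 < rho a b x" if "x \<in> unit_ivl" for x using that by (simp add: rho_def)
  have "(\<lambda>x. indicator unit_ivl x *\<^sub>R v x) \<in> borel_measurable lebesgue"
  proof -
    have [measurable]: "(\<lambda>x. sqrt (rho a b x)) \<in> borel_measurable lebesgue"
      "indicator unit_ivl \<in> borel_measurable lebesgue"
      by (intro measurable_completion; measurable)+
    show ?thesis using \<phi>(1) unfolding v_def by measurable
  qed
  moreover have "integrable lebesgue (\<lambda>x. indicator unit_ivl x *\<^sub>R (rho a b x * (v x)\<^sup>2))"
  proof -
    have "indicator unit_ivl x *\<^sub>R (rho a b x * (v x)\<^sup>2) = indicator unit_ivl x *\<^sub>R (\<phi> x)\<^sup>2" for x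
      using rho_pos[of x] by (auto simp: indicator_def v_def power_divide)
    moreover have "integrable lebesgue (\<lambda>x. indicator unit_ivl x *\<^sub>R (\<phi> x)\<^sup>2)"
      by (rule integrable_mult_indicator[OF _ \<phi>(2)]) simp
    ultimately show ?thesis by (simp only:)
  qed
  ultimately have "v \<in> wL2 a b" by (simp add: wL2_def set_borel_measurable_def set_integrable_def)
  moreover have "jcoef a b v j = d j" for j
  proof -
    have "indicator unit_ivl x *\<^sub>R (rho a b x * v x * Gn a b j x) = \<phi> x * e j x" for x
    proof (cases "x \<in> unit_ivl")
      case True
      then have "sqrt (rho a b x) \<noteq> 0" "rho a b x = sqrt (rho a b x) * sqrt (rho a b x)"
        using rho_pos[of x] by auto
      then have "rho a b x * v x = sqrt (rho a b x) * \<phi> x"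
        unfolding v_def by (metis mult.assoc nonzero_eq_divide_eq mult.commute)
      then show ?thesis using True by (simp add: e_def)
    qed (simp add: e_def)
    then show ?thesis using \<phi>(3)[of j] by (simp add: jcoef_def set_lebesgue_integral_def)
  qed
  ultimately show ?thesis using that by blast
qed

text \<open>Completeness of the Jacobi polynomials: they span all polynomials, so the weighted difference
  of the two functions has vanishing moments.\<close>

lemma wL2_eq_by_coefficients:
  assumes ab: "-1 < a" "-1 < b" and v: "v \<in> wL2 a b" and w: "w \<in> wL2 a b"
    and eq: "\<And>j. jcoef a b v j = jcoef a b w j"
  shows "AE x in lebesgue. x \<in> unit_ivl \<longrightarrow> v x = w x"
proof -
  define H where "H x = indicator unit_ivl x *\<^sub>R (rho a b x * v x * 1) - indicator unit_ivl x *\<^sub>R (rho a b x * w x * 1)" for x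
  define \<Lambda> where "\<Lambda> p = (\<integral>x. H x * poly p x \<partial>lebesgue)" for p
  have poly_wL2: "poly p \<in> wL2 a b" for p by (rule wL2_poly[OF ab]) simp
  have I: "integrable lebesgue (\<lambda>x. indicator unit_ivl x *\<^sub>R (rho a b x * u x * poly p x))" if "u \<in> wL2 a b" for u p
    using wL2_product_integrable[OF that poly_wL2[of p]] by (simp only: set_integrable_def)
  have H_eq: "H x * poly p x = indicator unit_ivl x *\<^sub>R (rho a b x * v x * poly p x)
      - indicator unit_ivl x *\<^sub>R (rho a b x * w x * poly p x)" for x p
    by (simp add: H_def algebra_simps)
  have IH: "integrable lebesgue (\<lambda>x. H x * poly p x)" for p
    unfolding H_eq using I[OF v, of p] I[OF w, of p] by simp
  have \<Lambda>_smult_diff: "\<Lambda> (p - smult c q) = \<Lambda> p - c * \<Lambda> q" for p q c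
  proof -
    have "H x * poly (p - smult c q) x = H x * poly p x - c * (H x * poly q x)" for x
      by (simp add: algebra_simps)
    then show ?thesis unfolding \<Lambda>_def using IH by simp
  qed
  have \<Lambda>_G: "\<Lambda> (Gpoly a b j) = 0" for j
  proof -
    have "\<Lambda> (smult (1 / G_norm a b j) (Gpoly a b j)) = jcoef a b v j - jcoef a b w j"
      unfolding \<Lambda>_def H_eq jcoef_def set_lebesgue_integral_def
      using I[OF v, of "smult (1 / G_norm a b j) (Gpoly a b j)"] I[OF w, of "smult (1 / G_norm a b j) (Gpoly a b j)"]
      by (simp only: Gn_poly Bochner_Integration.integral_diff)
    moreover have "\<Lambda> (smult (1 / G_norm a b j) (Gpoly a b j)) = (1 / G_norm a b j) * \<Lambda> (Gpoly a b j)"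
      using \<Lambda>_smult_diff[of 0 "- 1 / G_norm a b j" "Gpoly a b j"] by (simp add: \<Lambda>_def)
    ultimately show ?thesis using eq[of j] G_norm_pos[OF ab, of j] by simp
  qed
  have "\<Lambda> p = 0" for p
  proof (induction "degree p" arbitrary: p rule: less_induct)
    case less
    define n where "n = degree p"
    (* Subtracting a multiple of the Jacobi polynomial of the same degree lowers the degree. *)
    define c where "c = coeff p n / coeff (Gpoly a b n) n"
    define q where "q = p - smult c (Gpoly a b n)"
    have "\<Lambda> q = \<Lambda> p" by (simp add: q_def \<Lambda>_smult_diff \<Lambda>_G)
    moreover have "\<Lambda> q = 0"
    proof (cases "q = 0")
      case True
      then show ?thesis by (simp add: \<Lambda>_def)
    next
      case False
      have "degree q \<le> n"
        unfolding q_def using degree_Gpoly_le[of a b n]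
        by (intro degree_diff_le order_trans[OF degree_smult_le]) (auto simp: n_def)
      moreover have "coeff q n = 0" using coeff_Gpoly_pos[OF ab, of n] by (simp add: q_def c_def)
      ultimately have "degree q < n" using False by (metis le_neq_implies_less leading_coeff_0_iff)
      then show ?thesis by (intro less) (simp add: n_def)
    qed
    ultimately show ?case by simp
  qed
  moreover have "integrable lebesgue H" using IH[of 1] by simp
  ultimately have "AE x in lebesgue. H x = 0"
    by (intro zero_moments_imp_AE_zero) (simp_all only: \<Lambda>_def, auto simp: H_def indicator_def)
  then show ?thesis
    by eventually_elim (auto simp: H_def rho_def)
qed

section \<open>The boundary value problem in Jacobi coefficients\<close>

lemma sobolev_weight_pos: "0 < (1 + (real j)\<^sup>2) powr s"
proof -
  have "0 < 1 + (real j)\<^sup>2" by (rule add_pos_nonneg) auto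
  then show ?thesis by simp
qed

lemma sob_summable:
  "f \<in> sob s a b \<Longrightarrow> summable (\<lambda>j. (1 + (real j)\<^sup>2) powr s * (coef a b f j)\<^sup>2)"
  by (auto simp: sob_def split: if_splits)

lemma coef_embed: "coef a b (embed s a b g) = jcoef a b g"
  by (simp add: embed_def fun_eq_iff)

text \<open>For \<open>s \<ge> 0\<close> the weights are at least \<open>1\<close>, so the sequence is square summable and the theorem
  of Riesz and Fischer supplies the function; for \<open>s < 0\<close> the formal series is the element.\<close>

lemma sob_with_coefficients:
  assumes ab: "-1 < a" "-1 < b" and d: "summable (\<lambda>j. (1 + (real j)\<^sup>2) powr s * (d j)\<^sup>2)"
  obtains \<phi> where "\<phi> \<in> sob s a b" "\<And>j. coef a b \<phi> j = d j"
proof (cases "0 \<le> s")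
  case True
  have "summable (\<lambda>j. (d j)\<^sup>2)"
  proof (rule summable_comparison_test'[OF d, of 0])
    fix j :: nat
    have "1 \<le> (1 + (real j)\<^sup>2) powr s" using True by (intro ge_one_powr_ge_zero) auto
    then show "norm ((d j)\<^sup>2) \<le> (1 + (real j)\<^sup>2) powr s * (d j)\<^sup>2"
      using mult_right_mono[of 1 "(1 + (real j)\<^sup>2) powr s" "(d j)\<^sup>2"] by simp
  qed
  then obtain v where v: "v \<in> wL2 a b" "\<And>j. jcoef a b v j = d j"
    by (rule wL2_with_coefficients[OF ab]) (rule that)
  then have "Fn v \<in> sob s a b" using True d by (simp add: sob_def)
  with v(2) show ?thesis using that[of "Fn v"] by simp
next
  case False
  then have "Series d (Gn a b) \<in> sob s a b" using d by (auto simp: sob_def)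
  then show ?thesis using that[of "Series d (Gn a b)"] by simp
qed

text \<open>For \<open>s \<ge> 0\<close> by completeness of the Jacobi polynomials, for \<open>s < 0\<close> by the definition of the
  space as a set of formal series.\<close>

lemma weight_mult_eq_by_coefficients:
  assumes ab: "-1 < a" "-1 < b" and "\<phi> \<in> sob s a b" "\<psi> \<in> sob s a b"
    and eq: "\<And>j. coef a b \<phi> j = coef a b \<psi> j"
  shows "gfun_eq (weight_mult \<omega> \<phi>) (weight_mult \<omega> \<psi>)"
proof (cases "0 \<le> s")
  case True
  then obtain v w where vw: "\<phi> = Fn v" "\<psi> = Fn w" "v \<in> wL2 a b" "w \<in> wL2 a b"
    using assms by (auto simp: sob_def)
  then have "AE x in lebesgue. x \<in> unit_ivl \<longrightarrow> v x = w x"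
    using eq by (intro wL2_eq_by_coefficients[OF ab]) auto
  then show ?thesis unfolding vw weight_mult.simps gfun_eq.simps by eventually_elim simp
next
  case False
  then show ?thesis using assms by (auto simp: sob_def fun_eq_iff)
qed

lemma zero_bdry_weight_mult: "zero_bdry (weight_mult (rho a b) \<phi>)"
  by (cases \<phi>) (simp_all add: rho_def)

lemma finite_spectrum_embed:
  assumes ab: "-1 < a" "-1 < b"
    and g: "\<And>x. x \<in> unit_ivl \<Longrightarrow> g x = (\<Sum>j\<le>N. c j * Gn a b j x)"
  shows "embed s a b g \<in> sob s a b"
proof -
  have "g \<in> wL2 a b" by (rule jcoef_finite_sum(1)[OF ab]) (rule g)
  moreover have "jcoef a b g j = (if j \<le> N then c j else 0)" for j
    by (rule jcoef_finite_sum(2)[OF ab]) (rule g)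
  then have "summable (\<lambda>j. (1 + (real j)\<^sup>2) powr s * (jcoef a b g j)\<^sup>2)"
    by (intro summable_finite[of "{..N}"]) simp_all
  ultimately show ?thesis by (auto simp: embed_def sob_def)
qed

text \<open>Convergence of the truncations of \<open>h\<close> to \<open>f\<close> in a weighted sequence space forces
  \<open>h = f\<close> because each coordinate is eventually constant; conversely the distance is the tail of a
  convergent series.\<close>

lemma truncation_limit_iff:
  fixes w h f :: "nat \<Rightarrow> real"
  assumes w: "\<And>j. 0 < w j" and f: "summable (\<lambda>j. w j * (f j)\<^sup>2)"
  shows "(\<lambda>N. sqrt (\<Sum>j. w j * ((if j \<le> N then h j else 0) - f j)\<^sup>2)) \<longlonglongrightarrow> 0 \<longleftrightarrow> h = f"
    (is "?L \<longlonglongrightarrow> 0 \<longleftrightarrow> _")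
proof
  let ?D = "\<lambda>N j. w j * ((if j \<le> N then h j else 0) - f j)\<^sup>2"
  have sm: "summable (?D N)" for N
  proof (rule summable_comparison_test_ev[OF _ f])
    show "eventually (\<lambda>j. norm (?D N j) \<le> w j * (f j)\<^sup>2) sequentially"
      using w by (intro eventually_sequentiallyI[of "Suc N"]) (simp add: less_imp_le)
  qed
  have nonneg: "0 \<le> ?D N j" for N j using w[of j] by simp
  {
    assume lim: "?L \<longlonglongrightarrow> 0"
    show "h = f"
    proof
      fix j
      have "(\<lambda>N. (?L N)\<^sup>2) \<longlonglongrightarrow> 0\<^sup>2" by (intro tendsto_power lim)
      moreover have "(?L N)\<^sup>2 = (\<Sum>j. ?D N j)" for N
        using suminf_nonneg[OF sm nonneg] by simp
      ultimately have "(\<lambda>N. \<Sum>j. ?D N j) \<longlonglongrightarrow> 0" by simp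
      moreover have "eventually (\<lambda>N. w j * (h j - f j)\<^sup>2 \<le> (\<Sum>j. ?D N j)) sequentially"
      proof (rule eventually_sequentiallyI[of j])
        fix N assume "j \<le> N"
        then show "w j * (h j - f j)\<^sup>2 \<le> (\<Sum>j. ?D N j)"
          using sum_le_suminf[OF sm, of "{j}" N] nonneg by simp
      qed
      ultimately have "w j * (h j - f j)\<^sup>2 \<le> 0"
        by (intro tendsto_lowerbound) auto
      then show "h j = f j" using w[of j] by (simp add: mult_le_0_iff)
    qed
  }
  {
    assume "h = f"
    have "(\<Sum>j. ?D N j) = (\<Sum>j. w j * (f j)\<^sup>2) - (\<Sum>j\<le>N. w j * (f j)\<^sup>2)" for N
    proof -
      have "?D N j = w j * (f j)\<^sup>2 - (if j \<in> {..N} then w j * (f j)\<^sup>2 else 0)" for j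
        using \<open>h = f\<close> by simp
      moreover have "(\<lambda>j. if j \<in> {..N} then w j * (f j)\<^sup>2 else 0) sums (\<Sum>j\<le>N. w j * (f j)\<^sup>2)"
        by (rule sums_If_finite_set) simp
      ultimately show ?thesis
        using sums_diff[OF summable_sums[OF f]] by (simp add: sums_iff)
    qed
    moreover have "(\<lambda>N. \<Sum>j\<le>N. w j * (f j)\<^sup>2) \<longlonglongrightarrow> (\<Sum>j. w j * (f j)\<^sup>2)"
      by (rule summable_LIMSEQ'[OF f])
    then have "(\<lambda>N. sqrt ((\<Sum>j. w j * (f j)\<^sup>2) - (\<Sum>j\<le>N. w j * (f j)\<^sup>2))) \<longlonglongrightarrow> sqrt ((\<Sum>j. w j * (f j)\<^sup>2) - (\<Sum>j. w j * (f j)\<^sup>2))"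
      by (intro tendsto_intros)
    ultimately show "?L \<longlonglongrightarrow> 0" by simp
  }
qed

context riesz_kernel
begin

lemma frac_op_partial_sum:
  assumes "x \<in> unit_ivl"
  shows "frac_op r (a + b) (\<lambda>x. rho a b x * partial_sum a b \<phi> N x) x
       = (\<Sum>j\<le>N. (eigval j * coef a b \<phi> j) * Gn b a j x)"
proof -
  have x: "0 < x" "x < 1" using assms by auto
  have "(\<lambda>x. rho a b x * partial_sum a b \<phi> N x)
      = (\<lambda>x. rho a b x * (\<Sum>j\<le>N. (coef a b \<phi> j / G_norm a b j) * poly (Gpoly a b j) x))"
    by (simp add: partial_sum_def Gn_eq poly_Gpoly)
  then have "frac_op r (a + b) (\<lambda>x. rho a b x * partial_sum a b \<phi> N x) x
    = (\<Sum>j\<le>N. (coef a b \<phi> j / G_norm a b j) * frac_op r (a + b) (\<lambda>x. rho a b x * poly (Gpoly a b j) x) x)"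
    by (simp only: frac_op_sum[OF finite_atMost x])
  also have "\<dots> = (\<Sum>j\<le>N. (coef a b \<phi> j / G_norm a b j) * (eigval j * G b a j x))"
    by (simp only: poly_Gpoly frac_op_jacobi[OF x])
  finally show ?thesis by (simp add: Gn_eq G_norm_swap[of a b] mult_ac)
qed

text \<open>In coefficients the equation is diagonal, since each partial sum is a finite combination of
  eigenfunctions.\<close>

lemma op_limit_iff:
  assumes f: "f \<in> sob s b a"
  shows "op_limit r (a + b) b s \<phi> f \<longleftrightarrow> (\<forall>j. eigval j * coef a b \<phi> j = coef b a f j)"
proof -
  have ab: "-1 < b" "-1 < a" using a b by auto
  define g where "g N = frac_op r (a + b) (\<lambda>x. rho a b x * partial_sum a b \<phi> N x)" for N
  have g: "g N x = (\<Sum>j\<le>N. (eigval j * coef a b \<phi> j) * Gn b a j x)" if "x \<in> unit_ivl" for N x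
    unfolding g_def by (rule frac_op_partial_sum[OF that])
  have wL2: "g N \<in> wL2 b a" for N
    by (rule jcoef_finite_sum(1)[OF ab]) (rule g)
  have jcoef: "jcoef b a (g N) j = (if j \<le> N then eigval j * coef a b \<phi> j else 0)" for N j
    by (rule jcoef_finite_sum(2)[OF ab]) (rule g)
  have sob: "embed s b a (g N) \<in> sob s b a" for N
    by (rule finite_spectrum_embed[OF ab]) (rule g)
  have "op_limit r (a + b) b s \<phi> f \<longleftrightarrow> (\<lambda>N. sob_dist s b a (embed s b a (g N)) f) \<longlonglongrightarrow> 0"
    using wL2 sob by (simp add: op_limit_def g_def Let_def)
  also have "\<dots> \<longleftrightarrow> (\<lambda>j. eigval j * coef a b \<phi> j) = coef b a f"
    unfolding sob_dist_def coef_embed jcoef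
    by (rule truncation_limit_iff[OF sobolev_weight_pos sob_summable[OF f]])
  finally show ?thesis by (simp add: fun_eq_iff)
qed

end

theorem corollary1:
  fixes \<alpha> r s \<beta> :: real
  assumes "1 < \<alpha>" and "\<alpha> < 2"
    and "0 \<le> r" and "r \<le> 1"
    and "\<alpha> - 1 \<le> \<beta>" and "\<beta> \<le> 1"
    and "r = sin (pi * \<beta>) / (sin (pi * (\<alpha> - \<beta>)) + sin (pi * \<beta>))"
  shows "\<exists>C. \<forall>f\<in>sob s \<beta> (\<alpha> - \<beta>).
           \<exists>u. is_solution r \<alpha> \<beta> s f u \<and>
               (\<forall>w. is_solution r \<alpha> \<beta> s f w \<longrightarrow> gfun_eq w u) \<and>
               (\<exists>\<phi>\<in>sob (s + \<alpha>) (\<alpha> - \<beta>) \<beta>.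
                  u = weight_mult (rho (\<alpha> - \<beta>) \<beta>) \<phi> \<and>
                  sob_norm (s + \<alpha>) (\<alpha> - \<beta>) \<beta> \<phi> \<le> C * sob_norm s \<beta> (\<alpha> - \<beta>) f)"
proof -
  define a where "a = \<alpha> - \<beta>"
  have balance: "r * sin (pi * a) = (1 - r) * sin (pi * \<beta>)"
  proof -
    have "0 \<le> sin (pi * a)" "0 \<le> sin (pi * \<beta>)"
      using assms by (auto simp: a_def intro!: sin_ge_zero mult_nonneg_nonneg)
    (* If the denominator vanishes then so do both sines. *)
    then show ?thesis
      unfolding assms(7) a_def[symmetric]
      by (cases "sin (pi * a) + sin (pi * \<beta>) = 0") (auto simp: field_simps add_nonneg_eq_0_iff)
  qed
  interpret riesz_kernel a \<beta> r
    by unfold_locales (use assms balance in \<open>auto simp: a_def\<close>)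
  have \<alpha>: "a + \<beta> = \<alpha>" by (simp add: a_def)
  have ab: "-1 < a" "-1 < \<beta>" using a b by auto
  let ?w = "\<lambda>s j. (1 + (real j)\<^sup>2) powr s"
  have solution_iff: "is_solution r \<alpha> \<beta> s f u \<longleftrightarrow>
      (\<exists>\<phi>\<in>sob (s + \<alpha>) a \<beta>. u = weight_mult (rho a \<beta>) \<phi> \<and> (\<forall>j. eigval j * coef a \<beta> \<phi> j = coef \<beta> a f j))"
    if "f \<in> sob s \<beta> a" for f u
    unfolding is_solution_def a_def[symmetric]
    using op_limit_iff[OF that, unfolded \<alpha>] zero_bdry_weight_mult[of a \<beta>] by auto
  obtain c where c: "0 < c" "\<And>n. c * (1 + (real n)\<^sup>2) powr (\<alpha> / 2) \<le> eigval n"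
    by (rule eigval_lower_bound[unfolded \<alpha>]) (rule that)
  have "\<exists>u. is_solution r \<alpha> \<beta> s f u \<and> (\<forall>w. is_solution r \<alpha> \<beta> s f w \<longrightarrow> gfun_eq w u) \<and>
               (\<exists>\<phi>\<in>sob (s + \<alpha>) a \<beta>. u = weight_mult (rho a \<beta>) \<phi> \<and>
                  sob_norm (s + \<alpha>) a \<beta> \<phi> \<le> 1 / c * sob_norm s \<beta> a f)"
    if f: "f \<in> sob s \<beta> a" for f
  proof -
    (* In the Jacobi bases the operator multiplies the j-th coefficient by the j-th eigenvalue,
       so these are the only possible coefficients of the solution. *)
    define d where "d j = coef \<beta> a f j / eigval j" for j
    have d_le: "?w (s + \<alpha>) j * (d j)\<^sup>2 \<le> (1 / c)\<^sup>2 * (?w s j * (coef \<beta> a f j)\<^sup>2)" for j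
    proof -
      have pos: "0 < c * ?w (\<alpha> / 2) j"
        using c(1) by (intro mult_pos_pos sobolev_weight_pos)
      have "?w (\<alpha> / 2) j * ?w (\<alpha> / 2) j = ?w \<alpha> j" by (simp flip: powr_add)
      then have "c\<^sup>2 * ?w \<alpha> j = (c * ?w (\<alpha> / 2) j)\<^sup>2" by (simp add: power2_eq_square mult_ac)
      also have "\<dots> \<le> (eigval j)\<^sup>2" using c(2)[of j] pos by (intro power_mono) auto
      finally have "?w \<alpha> j / (eigval j)\<^sup>2 \<le> (1 / c)\<^sup>2"
        using c(1) eigval_pos[of j] by (simp add: power_divide field_simps)
      then have "?w \<alpha> j / (eigval j)\<^sup>2 * (?w s j * (coef \<beta> a f j)\<^sup>2) \<le> (1 / c)\<^sup>2 * (?w s j * (coef \<beta> a f j)\<^sup>2)"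
        by (rule mult_right_mono) simp
      moreover have "?w (s + \<alpha>) j = ?w s j * ?w \<alpha> j" by (rule powr_add)
      ultimately show ?thesis by (simp add: d_def power_divide mult_ac)
    qed
    have f_sum: "summable (\<lambda>j. (1 / c)\<^sup>2 * (?w s j * (coef \<beta> a f j)\<^sup>2))"
      by (intro summable_mult sob_summable f)
    have d_sum: "summable (\<lambda>j. ?w (s + \<alpha>) j * (d j)\<^sup>2)"
      by (rule summable_comparison_test'[OF f_sum, of 0]) (use d_le in simp)
    obtain \<phi> where \<phi>: "\<phi> \<in> sob (s + \<alpha>) a \<beta>" "\<And>j. coef a \<beta> \<phi> j = d j"
      by (rule sob_with_coefficients[OF ab d_sum]) (rule that)
    have "is_solution r \<alpha> \<beta> s f (weight_mult (rho a \<beta>) \<phi>)"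
      using \<phi> eigval_pos by (auto simp: solution_iff[OF f] d_def less_imp_neq[symmetric])
    moreover have "gfun_eq w (weight_mult (rho a \<beta>) \<phi>)" if w: "is_solution r \<alpha> \<beta> s f w" for w
    proof -
      obtain \<psi> where \<psi>: "\<psi> \<in> sob (s + \<alpha>) a \<beta>" "w = weight_mult (rho a \<beta>) \<psi>"
        "\<And>j. eigval j * coef a \<beta> \<psi> j = coef \<beta> a f j"
        using w by (auto simp: solution_iff[OF f])
      have "coef a \<beta> \<psi> j = coef a \<beta> \<phi> j" for j
        using \<psi>(3)[of j] eigval_pos[of j] by (simp add: \<phi>(2) d_def field_simps)
      then show ?thesis
        unfolding \<psi>(2) by (rule weight_mult_eq_by_coefficients[OF ab \<psi>(1) \<phi>(1)])
    qed
    moreover have "sob_norm (s + \<alpha>) a \<beta> \<phi> \<le> 1 / c * sob_norm s \<beta> a f"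
    proof -
      have "(\<Sum>j. ?w (s + \<alpha>) j * (d j)\<^sup>2) \<le> (\<Sum>j. (1 / c)\<^sup>2 * (?w s j * (coef \<beta> a f j)\<^sup>2))"
        by (intro suminf_le d_le d_sum f_sum)
      also have "\<dots> = (1 / c)\<^sup>2 * (\<Sum>j. ?w s j * (coef \<beta> a f j)\<^sup>2)"
        by (intro suminf_mult sob_summable f)
      finally show ?thesis
        using c(1) real_sqrt_le_mono by (fastforce simp: sob_norm_def \<phi>(2) real_sqrt_mult)
    qed
    ultimately show ?thesis using \<phi>(1) by blast
  qed
  then show ?thesis unfolding a_def by blast
qed

end
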